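(* Let $K$ be a field of characteristic $\ne2,3$. Every linear transformation of the space $\wedge^3_0(K^6)$ that preserves the $\mathrm{Sp}_6$-invariant quartic form is of the form $$v_1\wedge v_2\wedge v_3\mapsto c\,(gv_1\wedge gv_2\wedge gv_3)\quad\text{for some } c\in K^\times\text{ and } g\in\mathrm{GSp}_6(K)$$ with $c^4(\det g)^2=1$.
   Context: $\mathrm{Sp}_6$ is the subgroup of $\mathrm{GL}_6$ preserving a fixed nondegenerate skew-symmetric bilinear form $b$ on $K^6$, and $\mathrm{GSp}_6$ is the subgroup of $\mathrm{GL}_6$ of transformations that scale $b$ by a factor in $K^\times$. $\wedge^3_0(K^6)$ is the ($14$-dimensional) kernel of the contraction map $\wedge^3(K^6)\to K^6$, $v_1\wedge v_2\wedge v_3\mapsto b(v_1,v_2)v_3-b(v_1,v_3)v_2+b(v_2,v_3)v_1$. The displayed formula means the restriction to $\wedge^3_0(K^6)$ of the linear map of $\wedge^3(K^6)$ so defined on decomposable vectors. The $\mathrm{Sp}_6$-invariant quartic form is the restriction to $\wedge^3_0(K^6)$ of the $\mathrm{SL}_6$-invariant quartic form on $\wedge^3(K^6)$ (the degree-$4$ homogeneous generator, unique up to scalar, of the ring of $\mathrm{SL}_6$-invariant polynomial functions on $\wedge^3(K^6)$); it generates the ring of $\mathrm{Sp}_6$-invariant polynomial functions on $\wedge^3_0(K^6)$. A linear transformation $\phi$ preserves a form $f$ if $f\circ\phi=f$ as polynomials. *)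

theory Defs
  imports "HOL-Analysis.Analysis" "HOL-Algebra.Algebraic_Closure_Type"
begin

no_notation fps_nth (infixl \<open>$\<close> 75)

text \<open>
  The exterior cube \<open>\<and>\<^sup>3(K\<^sup>6)\<close> is realised, over any field, as the space of alternating
  \<open>6 \<times> 6 \<times> 6\<close> arrays inside \<open>K ^ (6 \<times> 6 \<times> 6)\<close>; the decomposable vector \<open>u \<and> v \<and> w\<close> is the
  array of \<open>3 \<times> 3\<close> minors of the matrix with columns \<open>u\<close>, \<open>v\<close>, \<open>w\<close>.
\<close>

definition trivectors :: "('a::field ^ (6 \<times> 6 \<times> 6)) set" where
  "trivectors = {T. \<forall>i j k.
     T $ (i, i, k) = 0 \<and> T $ (i, k, i) = 0 \<and> T $ (k, i, i) = 0 \<and>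
     T $ (j, i, k) = - T $ (i, j, k) \<and> T $ (i, k, j) = - T $ (i, j, k)}"

definition wedge3 :: "'a::field ^ 6 \<Rightarrow> 'a ^ 6 \<Rightarrow> 'a ^ 6 \<Rightarrow> 'a ^ (6 \<times> 6 \<times> 6)" where
  "wedge3 u v w = (\<chi> x. case x of (i, j, k) \<Rightarrow>
       u$i * v$j * w$k + v$i * w$j * u$k + w$i * u$j * v$k
     - v$i * u$j * w$k - u$i * w$j * v$k - w$i * v$j * u$k)"

lemma wedge3_in_trivectors: "wedge3 u v w \<in> trivectors"
  by (simp add: trivectors_def wedge3_def algebra_simps)

text \<open>The linear map \<open>\<and>\<^sup>3 g\<close>; it is determined by lemma \<open>ext3_wedge3\<close> below.\<close>

definition ext3 :: "'a::field ^ 6 ^ 6 \<Rightarrow> 'a ^ (6 \<times> 6 \<times> 6) \<Rightarrow> 'a ^ (6 \<times> 6 \<times> 6)" where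
  "ext3 g T = (\<chi> x. case x of (i, j, k) \<Rightarrow>
     \<Sum>p\<in>UNIV. \<Sum>q\<in>UNIV. \<Sum>r\<in>UNIV. g$i$p * g$j$q * g$k$r * T $ (p, q, r))"

lemma linear_ext3: "Vector_Spaces.linear (*s) (*s) (ext3 g)"
proof unfold_locales
  show "ext3 g (x + y) = ext3 g x + ext3 g y" for x y
    by (simp add: ext3_def vec_eq_iff case_prod_beta distrib_left sum.distrib)
  show "ext3 g (c *s x) = c *s ext3 g x" for c x
    by (simp add: ext3_def vec_eq_iff case_prod_beta sum_distrib_left mult.left_commute)
qed

text \<open>
  The contraction attached to \<open>b\<close>. Summing over all pairs of indices counts each term twice,
  whence the division by \<open>2\<close>; see lemma \<open>contraction_wedge3\<close> for its values on decomposable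
  vectors.
\<close>

definition contraction ::
  "('a::field ^ 6 \<Rightarrow> 'a ^ 6 \<Rightarrow> 'a) \<Rightarrow> 'a ^ (6 \<times> 6 \<times> 6) \<Rightarrow> 'a ^ 6" where
  "contraction b T =
     (\<chi> k. (\<Sum>i\<in>UNIV. \<Sum>j\<in>UNIV. b (axis i 1) (axis j 1) * T $ (i, j, k)) / 2)"

lemma linear_contraction: "Vector_Spaces.linear (*s) (*s) (contraction b)"
proof unfold_locales
  show "contraction b (x + y) = contraction b x + contraction b y" for x y
    by (simp add: contraction_def vec_eq_iff distrib_left sum.distrib add_divide_distrib)
  show "contraction b (c *s x) = c *s contraction b x" for c x
    by (simp add: contraction_def vec_eq_iff sum_distrib_left mult.left_commute)
qed

definition primitive_trivectors ::
  "('a::field ^ 6 \<Rightarrow> 'a ^ 6 \<Rightarrow> 'a) \<Rightarrow> ('a ^ (6 \<times> 6 \<times> 6)) set" where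
  "primitive_trivectors b = {T \<in> trivectors. contraction b T = 0}"

definition symplectic_form :: "('a::field ^ 6 \<Rightarrow> 'a ^ 6 \<Rightarrow> 'a) \<Rightarrow> bool" where
  "symplectic_form b \<longleftrightarrow>
     (\<forall>u. Vector_Spaces.linear (*s) (*) (\<lambda>v. b u v)) \<and>
     (\<forall>v. Vector_Spaces.linear (*s) (*) (\<lambda>u. b u v)) \<and>
     (\<forall>u v. b u v = - b v u) \<and>
     (\<forall>u. (\<forall>v. b u v = 0) \<longrightarrow> u = 0)"

definition GSp :: "('a::field ^ 6 \<Rightarrow> 'a ^ 6 \<Rightarrow> 'a) \<Rightarrow> ('a ^ 6 ^ 6) set" where
  "GSp b = {g. invertible g \<and> (\<exists>m. m \<noteq> 0 \<and> (\<forall>u v. b (g *v u) (g *v v) = m * b u v))}"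

definition linear_endo_on :: "('a::field ^ 'n) set \<Rightarrow> ('a ^ 'n \<Rightarrow> 'a ^ 'n) \<Rightarrow> bool" where
  "linear_endo_on S \<phi> \<longleftrightarrow>
     (\<forall>x\<in>S. \<phi> x \<in> S) \<and>
     (\<forall>x\<in>S. \<forall>y\<in>S. \<phi> (x + y) = \<phi> x + \<phi> y) \<and>
     (\<forall>c. \<forall>x\<in>S. \<phi> (c *s x) = c *s \<phi> x)"

text \<open>
  Polynomials with coefficients in \<open>K\<close> are represented by the functions they define on points
  over the algebraic closure of \<open>K\<close>. As that field is infinite, this is faithful even when \<open>K\<close>
  is finite. A polynomial on \<open>\<and>\<^sup>3(K\<^sup>6)\<close> is the restriction to \<open>trivectors\<close>, over the
  closure, of such a function in the \<open>216\<close> coordinates; its values elsewhere never matter.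
\<close>

definition monomial_fun :: "('n \<Rightarrow> nat) \<Rightarrow> 'a::field ^ 'n \<Rightarrow> 'a" where
  "monomial_fun m x = (\<Prod>i\<in>UNIV. (x $ i) ^ m i)"

definition poly_funs :: "('k::field alg_closure ^ 'n \<Rightarrow> 'k alg_closure) set" where
  "poly_funs = {F. \<exists>M a. finite M \<and> F = (\<lambda>x. \<Sum>m\<in>M. to_ac (a m) * monomial_fun m x)}"

definition forms :: "nat \<Rightarrow> ('k::field alg_closure ^ 'n \<Rightarrow> 'k alg_closure) set" where
  "forms d = {F. \<exists>M a. finite M \<and> (\<forall>m\<in>M. (\<Sum>i\<in>UNIV. m i) = d) \<and>
                       F = (\<lambda>x. \<Sum>m\<in>M. to_ac (a m) * monomial_fun m x)}"

text \<open>
  Invariance is under the algebraic group \<open>SL\<^sub>6\<close>, that is, under its points over the algebraic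
  closure (for finite \<open>K\<close> the group \<open>SL\<^sub>6(K)\<close> itself would have further invariants).
\<close>

definition SL6_invariant ::
  "('k::field alg_closure ^ (6 \<times> 6 \<times> 6) \<Rightarrow> 'k alg_closure) \<Rightarrow> bool" where
  "SL6_invariant F \<longleftrightarrow> (\<forall>g. det g = 1 \<longrightarrow> (\<forall>T\<in>trivectors. F (ext3 g T) = F T))"

text \<open>
  \<open>F\<close> is a quartic form generating, as a \<open>K\<close>-algebra, the ring of \<open>SL\<^sub>6\<close>-invariant polynomials
  on \<open>\<and>\<^sup>3(K\<^sup>6)\<close>. This determines \<open>F\<close> on \<open>trivectors\<close> up to a factor in \<open>K\<^sup>\<times>\<close>.
\<close>

definition SL6_invariant_quartic ::
  "('k::field alg_closure ^ (6 \<times> 6 \<times> 6) \<Rightarrow> 'k alg_closure) \<Rightarrow> bool" where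
  "SL6_invariant_quartic F \<longleftrightarrow>
     F \<in> forms 4 \<and> (\<exists>T\<in>trivectors. F T \<noteq> 0) \<and> SL6_invariant F \<and>
     (\<forall>G\<in>poly_funs. SL6_invariant G \<longrightarrow>
        (\<exists>p :: 'k poly. \<forall>T\<in>trivectors. G T = poly (map_poly to_ac p) (F T)))"

definition vec_to_ac :: "'k::field ^ 'n \<Rightarrow> 'k alg_closure ^ 'n" where
  "vec_to_ac x = (\<chi> i. to_ac (x $ i))"

text \<open>
  \<open>F \<circ> \<phi> = F\<close> as polynomials on the \<open>K\<close>-subspace \<open>S\<close>: the points of \<open>S\<close> over the algebraic
  closure are the combinations \<open>\<Sum> t\<^sub>i x\<^sub>i\<close> with \<open>x\<^sub>i \<in> S\<close> and \<open>t\<^sub>i\<close> in the closure, and the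
  scalar extension of \<open>\<phi>\<close> sends such a point to \<open>\<Sum> t\<^sub>i \<phi>(x\<^sub>i)\<close>.
\<close>

definition preserves_on ::
  "('k::field ^ 'n) set \<Rightarrow> ('k alg_closure ^ 'n \<Rightarrow> 'k alg_closure) \<Rightarrow> ('k ^ 'n \<Rightarrow> 'k ^ 'n) \<Rightarrow> bool" where
  "preserves_on S F \<phi> \<longleftrightarrow>
     (\<forall>(n::nat) x t. (\<forall>i<n. x i \<in> S) \<longrightarrow>
        F (\<Sum>i<n. t i *s vec_to_ac (\<phi> (x i))) = F (\<Sum>i<n. t i *s vec_to_ac (x i)))"

lemma triple_sum_prod:
  fixes A B C :: "6 \<Rightarrow> 'a::field"
  shows "(\<Sum>p\<in>UNIV. \<Sum>q\<in>UNIV. \<Sum>r\<in>UNIV. A p * B q * C r) =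
         (\<Sum>p\<in>UNIV. A p) * (\<Sum>q\<in>UNIV. B q) * (\<Sum>r\<in>UNIV. C r)"
  by (simp only: sum_distrib_left [symmetric] sum_distrib_right [symmetric] mult.assoc)

lemma ext3_wedge3: "ext3 g (wedge3 u v w) = wedge3 (g *v u) (g *v v) (g *v w)"
proof -
  have "ext3 g (wedge3 u v w) $ (i, j, k) = wedge3 (g *v u) (g *v v) (g *v w) $ (i, j, k)"
    for i j k
  proof -
    have S: "(g *v x) $ i * (g *v y) $ j * (g *v z) $ k =
        (\<Sum>p\<in>UNIV. \<Sum>q\<in>UNIV. \<Sum>r\<in>UNIV. (g$i$p * x$p) * (g$j$q * y$q) * (g$k$r * z$r))"
      for x y z
      by (simp only: triple_sum_prod matrix_vector_mult_def vec_lambda_beta)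
    show ?thesis
      unfolding ext3_def wedge3_def vec_lambda_beta prod.case S
        sum.distrib [symmetric] sum_subtractf [symmetric]
      by (intro sum.cong refl) (simp add: algebra_simps)
  qed
  then show ?thesis by (auto simp: vec_eq_iff)
qed

lemma symplectic_form_coords:
  assumes "symplectic_form b"
  shows "b u v = (\<Sum>i\<in>UNIV. \<Sum>j\<in>UNIV. b (axis i 1) (axis j 1) * (u$i * v$j))"
proof -
  have l: "\<And>u. Vector_Spaces.linear (*s) (*) (\<lambda>v. b u v)"
    and r: "\<And>v. Vector_Spaces.linear (*s) (*) (\<lambda>u. b u v)"
    using assms unfolding symplectic_form_def by blast+
  have A: "b u v = (\<Sum>j\<in>UNIV. v$j * b u (axis j 1))" for u v
  proof -
    interpret L: Vector_Spaces.linear "(*s)" "(*)" "\<lambda>v. b u v" by (rule l)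
    have "b u (\<Sum>j\<in>UNIV. v$j *s axis j 1) = (\<Sum>j\<in>UNIV. v$j * b u (axis j 1))"
      by (simp only: L.sum L.scale)
    then show ?thesis by (simp only: basis_expansion)
  qed
  have B: "b u v = (\<Sum>i\<in>UNIV. u$i * b (axis i 1) v)" for u v
  proof -
    interpret L: Vector_Spaces.linear "(*s)" "(*)" "\<lambda>u. b u v" by (rule r)
    have "b (\<Sum>i\<in>UNIV. u$i *s axis i 1) v = (\<Sum>i\<in>UNIV. u$i * b (axis i 1) v)"
      by (simp only: L.sum L.scale)
    then show ?thesis by (simp only: basis_expansion)
  qed
  have "b u v = (\<Sum>i\<in>UNIV. u$i * (\<Sum>j\<in>UNIV. v$j * b (axis i 1) (axis j 1)))"
    unfolding B [of u v] by (intro sum.cong refl arg_cong2 [where f = "(*)"] A)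
  also have "\<dots> = (\<Sum>i\<in>UNIV. \<Sum>j\<in>UNIV. b (axis i 1) (axis j 1) * (u$i * v$j))"
    unfolding sum_distrib_left by (intro sum.cong refl) (simp only: ac_simps)
  finally show ?thesis .
qed

lemma contraction_wedge3:
  fixes b :: "'a::field ^ 6 \<Rightarrow> 'a ^ 6 \<Rightarrow> 'a"
  assumes b: "symplectic_form b" and char: "(2::'a) \<noteq> 0"
  shows "contraction b (wedge3 u v w) = b u v *s w - b u w *s v + b v w *s u"
proof -
  have skew: "b v u = - b u v" "b w u = - b u w" "b w v = - b v w"
    using b unfolding symplectic_form_def by blast+
  have S: "b x y * z = (\<Sum>i\<in>UNIV. \<Sum>j\<in>UNIV. b (axis i 1) (axis j 1) * (x$i * y$j * z))"
    for x y z
    unfolding symplectic_form_coords [OF b, of x y] sum_distrib_right mult.assoc ..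
  have "(\<Sum>i\<in>UNIV. \<Sum>j\<in>UNIV. b (axis i 1) (axis j 1) * wedge3 u v w $ (i, j, k)) =
      2 * (b u v * w$k - b u w * v$k + b v w * u$k)" for k
  proof -
    have "(\<Sum>i\<in>UNIV. \<Sum>j\<in>UNIV. b (axis i 1) (axis j 1) * wedge3 u v w $ (i, j, k)) =
        b u v * w$k + b v w * u$k + b w u * v$k
          - b v u * w$k - b u w * v$k - b w v * u$k"
      unfolding S [of u v "w$k"] S [of v w "u$k"] S [of w u "v$k"] S [of v u "w$k"]
        S [of u w "v$k"] S [of w v "u$k"] wedge3_def vec_lambda_beta prod.case
        sum.distrib [symmetric] sum_subtractf [symmetric]
      by (intro sum.cong refl) (simp add: algebra_simps)
    then show ?thesis by (simp add: skew algebra_simps)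
  qed
  then show ?thesis
    using char by (simp add: contraction_def vec_eq_iff)
qed

text \<open>In characteristic other than \<open>2\<close> and \<open>3\<close> the decomposable vectors span: the sum below
  runs over all ordered triples, so it meets each basis vector of \<open>\<and>\<^sup>3(K\<^sup>6)\<close> six times.\<close>

lemma trivectors_eq_span:
  assumes char: "(2::'a::field) \<noteq> 0" "(3::'a) \<noteq> 0"
  shows "(trivectors :: ('a ^ (6 \<times> 6 \<times> 6)) set) = vec.span {wedge3 u v w |u v w. True}"
proof
  have sub: "vec.subspace (trivectors :: ('a ^ (6 \<times> 6 \<times> 6)) set)"
  proof (rule vec.subspaceI)
    show "(0 :: 'a ^ (6 \<times> 6 \<times> 6)) \<in> trivectors" by (simp add: trivectors_def)
  next
    fix x y :: "'a ^ (6 \<times> 6 \<times> 6)"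
    assume x: "x \<in> trivectors" and y: "y \<in> trivectors"
    show "x + y \<in> trivectors"
      unfolding trivectors_def mem_Collect_eq
    proof (intro allI)
      fix i j k
      show "(x + y) $ (i, i, k) = 0 \<and> (x + y) $ (i, k, i) = 0 \<and> (x + y) $ (k, i, i) = 0 \<and>
        (x + y) $ (j, i, k) = - (x + y) $ (i, j, k) \<and> (x + y) $ (i, k, j) = - (x + y) $ (i, j, k)"
        using x [unfolded trivectors_def mem_Collect_eq, rule_format, where i = i and j = j and k = k]
          y [unfolded trivectors_def mem_Collect_eq, rule_format, where i = i and j = j and k = k]
        by simp
    qed
  next
    fix c and x :: "'a ^ (6 \<times> 6 \<times> 6)"
    assume x: "x \<in> trivectors"
    show "c *s x \<in> trivectors"
      unfolding trivectors_def mem_Collect_eq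
    proof (intro allI)
      fix i j k
      show "(c *s x) $ (i, i, k) = 0 \<and> (c *s x) $ (i, k, i) = 0 \<and> (c *s x) $ (k, i, i) = 0 \<and>
        (c *s x) $ (j, i, k) = - (c *s x) $ (i, j, k) \<and> (c *s x) $ (i, k, j) = - (c *s x) $ (i, j, k)"
        using x [unfolded trivectors_def mem_Collect_eq, rule_format, where i = i and j = j and k = k]
        by simp
    qed
  qed
  show "vec.span {wedge3 u v w |u v w. True} \<subseteq> (trivectors :: ('a ^ (6 \<times> 6 \<times> 6)) set)"
    by (rule vec.span_minimal [OF _ sub]) (auto simp: wedge3_in_trivectors)
next
  have six: "(6::'a) \<noteq> 0"
  proof -
    have "(6::'a) = 2 * 3" by simp
    then show ?thesis using char by (metis mult_eq_0_iff)
  qed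
  show "(trivectors :: ('a ^ (6 \<times> 6 \<times> 6)) set) \<subseteq> vec.span {wedge3 u v w |u v w. True}"
  proof
    fix T :: "'a ^ (6 \<times> 6 \<times> 6)"
    assume T: "T \<in> trivectors"
    have s1: "T $ (j, i, k) = - T $ (i, j, k)" and s2: "T $ (i, k, j) = - T $ (i, j, k)" for i j k
      using T unfolding trivectors_def by blast+
    define E where "E = (\<Sum>i\<in>UNIV. \<Sum>j\<in>UNIV. \<Sum>k\<in>UNIV.
      T $ (i, j, k) *s (wedge3 (axis i 1) (axis j 1) (axis k 1) :: 'a ^ (6 \<times> 6 \<times> 6)))"
    have "E $ (p, q, r) = 6 * T $ (p, q, r)" for p q r
    proof -
      have *: "(\<Sum>i\<in>UNIV. \<Sum>j\<in>UNIV. \<Sum>k\<in>UNIV.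
          T $ (i, j, k) * (axis i 1 $ x * axis j 1 $ y * axis k 1 $ z)) = T $ (x, y, z)" for x y z
      proof -
        have "T $ (i, j, k) * (axis i 1 $ x * axis j 1 $ y * axis k 1 $ z) =
            (if k = z then if j = y then if i = x then T $ (i, j, k) else 0 else 0 else 0)"
          for i j k
          by (simp add: axis_def)
        then show ?thesis by simp
      qed
      have "E $ (p, q, r) = (\<Sum>i\<in>UNIV. \<Sum>j\<in>UNIV. \<Sum>k\<in>UNIV.
          T $ (i, j, k) * (axis i 1 $ p * axis j 1 $ q * axis k 1 $ r)
        + T $ (i, j, k) * (axis i 1 $ r * axis j 1 $ p * axis k 1 $ q)
        + T $ (i, j, k) * (axis i 1 $ q * axis j 1 $ r * axis k 1 $ p)
        - T $ (i, j, k) * (axis i 1 $ q * axis j 1 $ p * axis k 1 $ r)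
        - T $ (i, j, k) * (axis i 1 $ p * axis j 1 $ r * axis k 1 $ q)
        - T $ (i, j, k) * (axis i 1 $ r * axis j 1 $ q * axis k 1 $ p))"
        unfolding E_def wedge3_def sum_component vector_smult_component vec_lambda_beta prod.case
        by (intro sum.cong refl) (simp only: algebra_simps)
      also have "\<dots> = T $ (p, q, r) + T $ (r, p, q) + T $ (q, r, p)
          - T $ (q, p, r) - T $ (p, r, q) - T $ (r, q, p)"
        by (simp only: sum.distrib sum_subtractf *)
      also have "\<dots> = 6 * T $ (p, q, r)"
      proof -
        have "T $ (r, p, q) = T $ (p, q, r)" using s1 [of r p q] s2 [of p r q] by simp
        moreover have "T $ (q, r, p) = T $ (p, q, r)" using s1 [of q p r] s2 [of q r p] by simp
        moreover have "T $ (q, p, r) = - T $ (p, q, r)" by (rule s1)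
        moreover have "T $ (p, r, q) = - T $ (p, q, r)" by (rule s2)
        moreover have "T $ (r, q, p) = - T $ (q, r, p)" by (rule s1)
        ultimately show ?thesis by simp
      qed
      finally show ?thesis .
    qed
    then have T6: "T = (1/6) *s E" using six by (auto simp: vec_eq_iff)
    have E: "E \<in> vec.span {wedge3 u v w |u v w. True}"
      unfolding E_def by (intro vec.span_sum vec.span_scale vec.span_base) blast
    show "T \<in> vec.span {wedge3 u v w |u v w. True}"
      unfolding T6 by (rule vec.span_scale [OF E])
  qed
qed

end

(*
  Restricted to the primitive trivectors, the quartic is a multiple of
    q(a, A, B, d) = (ad - tr AB)^2 + 4 a det B + 4 d det A - 4 tr(A# B#)
  in the coordinates K + Sym_3 + Sym_3 + K given by a symplectic basis. Every SL_6-invariant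
  polynomial is a polynomial in F, so a map preserving F preserves Hitchin's quartic tr K_T^2,
  and F itself need not be computed.

  A linear map phi preserving q up to a factor permutes the nonzero x for which the Hessian of
  q at x has rank one. These are the decomposable x: the unipotent radicals of the two
  opposite Siegel parabolics move each of them to the line of E = (1,0,0,0), and then a second
  one, not orthogonal to E, to the line of (0,0,0,1) without moving E. So phi may be assumed
  to fix both lines; it is then block diagonal, acts on the second Sym_3 by a map sigma
  preserving det up to a factor, and its action on the first is determined by sigma. Such a
  sigma preserves the matrices of rank one, hence is B -> l P B P^T, and dividing by
  diag(P, cof P) leaves a map that is a multiple of diag(1,1,1,t,t,t).
*)
theory Submission
  imports Defs
begin

section \<open>The invariant quartic\<close>

text \<open>Once \<open>F\<close> has been traded for \<open>quartic\<close>, only values at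
  \<open>K\<close>-points are used: derivatives become the fixed combinations of values
  \<open>hess\<close> and \<open>grad\<close>, rank one of the Hessian is phrased as vanishing only
  on the radical, and polynomial identities are split into homogeneous parts by the substitutions C
  -> -C and C -> 2C. The maps used for normalisation multiply the quartic by nonzero factors. The
  classification is therefore carried out for similitudes with an arbitrary factor \<open>k\<close>,
  and the relation between \<open>c\<close> and \<open>det g\<close> is recovered at the end from a
  single vector on which the quartic is nonzero. Hitchin's construction is equivariant under GL_6,
  so invariance of the quartic comes without expanding it; the explicit formula is computed in
  symplectic coordinates only.\<close>

lemma UNIV_6: "(UNIV :: 6 set) = {0, 1, 2, 3, 4, 5}"
  by (rule card_subset_eq [symmetric]) simp_all

lemma sum_6: "sum f (UNIV :: 6 set) = f 0 + f 1 + f 2 + f 3 + f 4 + f 5"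
  for f :: "6 \<Rightarrow> 'a::comm_monoid_add"
  unfolding UNIV_6 by (simp add: ac_simps)

lemma forall_6: "(\<forall>i::6. P i) \<longleftrightarrow> P 0 \<and> P 1 \<and> P 2 \<and> P 3 \<and> P 4 \<and> P 5"
proof -
  have "(\<forall>i::6. P i) \<longleftrightarrow> (\<forall>i\<in>UNIV. P i)" by simp
  also have "\<dots> \<longleftrightarrow> P 0 \<and> P 1 \<and> P 2 \<and> P 3 \<and> P 4 \<and> P 5" unfolding UNIV_6 by simp
  finally show ?thesis .
qed

definition vec6 :: "'x \<Rightarrow> 'x \<Rightarrow> 'x \<Rightarrow> 'x \<Rightarrow> 'x \<Rightarrow> 'x \<Rightarrow> 'x ^ 6" where
  "vec6 a b c d e f = (\<chi> i. if i = 0 then a else if i = 1 then b else if i = 2 then c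
      else if i = 3 then d else if i = 4 then e else f)"

lemma vec6_nth [simp]:
  "vec6 a b c d e f $ 0 = a" "vec6 a b c d e f $ 1 = b" "vec6 a b c d e f $ 2 = c"
  "vec6 a b c d e f $ 3 = d" "vec6 a b c d e f $ 4 = e" "vec6 a b c d e f $ 5 = f"
  by (simp_all add: vec6_def)

lemma vec6_eqI:
  "x $ 0 = y $ 0 \<Longrightarrow> x $ 1 = y $ 1 \<Longrightarrow> x $ 2 = y $ 2 \<Longrightarrow> x $ 3 = y $ 3 \<Longrightarrow> x $ 4 = y $ 4 \<Longrightarrow>
   x $ 5 = y $ 5 \<Longrightarrow> x = (y :: 'x ^ 6)"
  by (simp add: vec_eq_iff forall_6)

section \<open>Determinants as alternating functions of six vectors\<close>

definition alt6 :: "'a::comm_ring_1 ^ 6 \<Rightarrow> 'a ^ 6 \<Rightarrow> 'a ^ 6 \<Rightarrow> 'a ^ 6 \<Rightarrow> 'a ^ 6 \<Rightarrow> 'a ^ 6 \<Rightarrow> 'a" where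
  "alt6 u v w x y z = det (vec6 u v w x y z)"

lemma det_row_linear_combination:
  fixes M :: "'a::comm_ring_1 ^ 'n ^ 'n"
  assumes "finite S"
  shows "det (\<chi> i. if i = k then (\<Sum>j\<in>S. c j *s a j) else M $ i) =
    (\<Sum>j\<in>S. c j * det (\<chi> i. if i = k then a j else M $ i))"
  using assms by (simp add: det_linear_row_sum det_row_mul)

lemma alt6_sum:
  fixes c :: "6 \<Rightarrow> 'a::comm_ring_1"
  shows "alt6 (\<Sum>j\<in>UNIV. c j *s a j) v w x y z = (\<Sum>j\<in>UNIV. c j * alt6 (a j) v w x y z)"
    "alt6 u (\<Sum>j\<in>UNIV. c j *s a j) w x y z = (\<Sum>j\<in>UNIV. c j * alt6 u (a j) w x y z)"
    "alt6 u v (\<Sum>j\<in>UNIV. c j *s a j) x y z = (\<Sum>j\<in>UNIV. c j * alt6 u v (a j) x y z)"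
    "alt6 u v w (\<Sum>j\<in>UNIV. c j *s a j) y z = (\<Sum>j\<in>UNIV. c j * alt6 u v w (a j) y z)"
    "alt6 u v w x (\<Sum>j\<in>UNIV. c j *s a j) z = (\<Sum>j\<in>UNIV. c j * alt6 u v w x (a j) z)"
    "alt6 u v w x y (\<Sum>j\<in>UNIV. c j *s a j) = (\<Sum>j\<in>UNIV. c j * alt6 u v w x y (a j))"
proof -
  have V: "vec6 p v w x y z = (\<chi> i. if i = 0 then p else vec6 0 v w x y z $ i)"
    "vec6 u p w x y z = (\<chi> i. if i = 1 then p else vec6 u 0 w x y z $ i)"
    "vec6 u v p x y z = (\<chi> i. if i = 2 then p else vec6 u v 0 x y z $ i)"
    "vec6 u v w p y z = (\<chi> i. if i = 3 then p else vec6 u v w 0 y z $ i)"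
    "vec6 u v w x p z = (\<chi> i. if i = 4 then p else vec6 u v w x 0 z $ i)"
    "vec6 u v w x y p = (\<chi> i. if i = 5 then p else vec6 u v w x y 0 $ i)" for p :: "'a ^ 6"
    by (rule vec6_eqI; simp)+
  note D = det_row_linear_combination [OF finite [of UNIV], of _ c a]
  show "alt6 (\<Sum>j\<in>UNIV. c j *s a j) v w x y z = (\<Sum>j\<in>UNIV. c j * alt6 (a j) v w x y z)"
    unfolding alt6_def V(1) [of "\<Sum>j\<in>UNIV. c j *s a j"] V(1) [of "a _"] by (rule D)
  show "alt6 u (\<Sum>j\<in>UNIV. c j *s a j) w x y z = (\<Sum>j\<in>UNIV. c j * alt6 u (a j) w x y z)"
    unfolding alt6_def V(2) [of "\<Sum>j\<in>UNIV. c j *s a j"] V(2) [of "a _"] by (rule D)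
  show "alt6 u v (\<Sum>j\<in>UNIV. c j *s a j) x y z = (\<Sum>j\<in>UNIV. c j * alt6 u v (a j) x y z)"
    unfolding alt6_def V(3) [of "\<Sum>j\<in>UNIV. c j *s a j"] V(3) [of "a _"] by (rule D)
  show "alt6 u v w (\<Sum>j\<in>UNIV. c j *s a j) y z = (\<Sum>j\<in>UNIV. c j * alt6 u v w (a j) y z)"
    unfolding alt6_def V(4) [of "\<Sum>j\<in>UNIV. c j *s a j"] V(4) [of "a _"] by (rule D)
  show "alt6 u v w x (\<Sum>j\<in>UNIV. c j *s a j) z = (\<Sum>j\<in>UNIV. c j * alt6 u v w x (a j) z)"
    unfolding alt6_def V(5) [of "\<Sum>j\<in>UNIV. c j *s a j"] V(5) [of "a _"] by (rule D)
  show "alt6 u v w x y (\<Sum>j\<in>UNIV. c j *s a j) = (\<Sum>j\<in>UNIV. c j * alt6 u v w x y (a j))"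
    unfolding alt6_def V(6) [of "\<Sum>j\<in>UNIV. c j *s a j"] V(6) [of "a _"] by (rule D)
qed

text \<open>Adjacent swaps are enough: together with \<open>alt6_repeat\<close> they sort any list
  of basis vectors.\<close>

lemma alt6_swap:
  fixes u :: "'a::comm_ring_1 ^ 6"
  shows "alt6 v u w x y z = - alt6 u v w x y z" "alt6 u w v x y z = - alt6 u v w x y z"
    "alt6 u v x w y z = - alt6 u v w x y z" "alt6 u v w y x z = - alt6 u v w x y z"
    "alt6 u v w x z y = - alt6 u v w x y z"
proof -
  have D: "det (\<chi> i. vec6 u v w x y z $ Transposition.transpose m n i) =
      - det (vec6 u v w x y z)" if "m \<noteq> n" for m n
    using det_permute_rows [OF permutes_swap_id [of m UNIV n], of "vec6 u v w x y z"] that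
    by (simp add: sign_swap_id)
  have "vec6 v u w x y z = (\<chi> i. vec6 u v w x y z $ Transposition.transpose 0 1 i)"
    "vec6 u w v x y z = (\<chi> i. vec6 u v w x y z $ Transposition.transpose 1 2 i)"
    "vec6 u v x w y z = (\<chi> i. vec6 u v w x y z $ Transposition.transpose 2 3 i)"
    "vec6 u v w y x z = (\<chi> i. vec6 u v w x y z $ Transposition.transpose 3 4 i)"
    "vec6 u v w x z y = (\<chi> i. vec6 u v w x y z $ Transposition.transpose 4 5 i)"
    by (rule vec6_eqI; simp add: Transposition.transpose_def)+
  then show "alt6 v u w x y z = - alt6 u v w x y z" "alt6 u w v x y z = - alt6 u v w x y z"
    "alt6 u v x w y z = - alt6 u v w x y z" "alt6 u v w y x z = - alt6 u v w x y z"
    "alt6 u v w x z y = - alt6 u v w x y z"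
    by (simp_all add: alt6_def D)
qed

lemma alt6_repeat:
  fixes u :: "'a::comm_ring_1 ^ 6"
  shows "alt6 u u w x y z = 0" "alt6 u v u x y z = 0" "alt6 u v w u y z = 0"
    "alt6 u v w x u z = 0" "alt6 u v w x y u = 0"
    "alt6 u v v x y z = 0" "alt6 u v w v y z = 0" "alt6 u v w x v z = 0" "alt6 u v w x y v = 0"
    "alt6 u v w w y z = 0" "alt6 u v w x w z = 0" "alt6 u v w x y w = 0"
    "alt6 u v w x x z = 0" "alt6 u v w x y x = 0"
    "alt6 u v w x y y = 0"
proof -
  have D: "det M = 0" if "M $ m = M $ n" "m \<noteq> n" for M :: "'a ^ 6 ^ 6" and m n
    using det_identical_rows [of m n M] that by (simp add: row_def)
  show "alt6 u u w x y z = 0" unfolding alt6_def by (rule D [of _ 0 1]) simp_all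
  show "alt6 u v u x y z = 0" unfolding alt6_def by (rule D [of _ 0 2]) simp_all
  show "alt6 u v w u y z = 0" unfolding alt6_def by (rule D [of _ 0 3]) simp_all
  show "alt6 u v w x u z = 0" unfolding alt6_def by (rule D [of _ 0 4]) simp_all
  show "alt6 u v w x y u = 0" unfolding alt6_def by (rule D [of _ 0 5]) simp_all
  show "alt6 u v v x y z = 0" unfolding alt6_def by (rule D [of _ 1 2]) simp_all
  show "alt6 u v w v y z = 0" unfolding alt6_def by (rule D [of _ 1 3]) simp_all
  show "alt6 u v w x v z = 0" unfolding alt6_def by (rule D [of _ 1 4]) simp_all
  show "alt6 u v w x y v = 0" unfolding alt6_def by (rule D [of _ 1 5]) simp_all
  show "alt6 u v w w y z = 0" unfolding alt6_def by (rule D [of _ 2 3]) simp_all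
  show "alt6 u v w x w z = 0" unfolding alt6_def by (rule D [of _ 2 4]) simp_all
  show "alt6 u v w x y w = 0" unfolding alt6_def by (rule D [of _ 2 5]) simp_all
  show "alt6 u v w x x z = 0" unfolding alt6_def by (rule D [of _ 3 4]) simp_all
  show "alt6 u v w x y x = 0" unfolding alt6_def by (rule D [of _ 3 5]) simp_all
  show "alt6 u v w x y y = 0" unfolding alt6_def by (rule D [of _ 4 5]) simp_all
qed

lemma alt6_matrix_mult:
  "alt6 (g *v u) (g *v v) (g *v w) (g *v x) (g *v y) (g *v z) = det g * alt6 u v w x y z"
proof -
  have "vec6 (g *v u) (g *v v) (g *v w) (g *v x) (g *v y) (g *v z) =
      vec6 u v w x y z ** transpose g"
    by (rule vec6_eqI;
      simp add: vec_eq_iff matrix_matrix_mult_def matrix_vector_mult_def transpose_def mult.commute)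
  then show ?thesis
    by (simp add: alt6_def det_mul det_transpose mult.commute)
qed

section \<open>Hitchin's quartic and its equivariance\<close>

definition eps :: "6 \<Rightarrow> 6 \<Rightarrow> 6 \<Rightarrow> 6 \<Rightarrow> 6 \<Rightarrow> 6 \<Rightarrow> 'a::comm_ring_1" where
  "eps i j k l m n = alt6 (axis i 1) (axis j 1) (axis k 1) (axis l 1) (axis m 1) (axis n 1)"

text \<open>On trivectors this is six times the coefficient of
  \<open>u \<and> v \<and> w \<and> T\<close> with respect to the standard volume, because the sum
  runs over ordered triples.\<close>

definition star :: "'a::field ^ (6 \<times> 6 \<times> 6) \<Rightarrow> 'a ^ 6 \<Rightarrow> 'a ^ 6 \<Rightarrow> 'a ^ 6 \<Rightarrow> 'a" where
  "star T u v w = (\<Sum>i\<in>UNIV. \<Sum>j\<in>UNIV. \<Sum>k\<in>UNIV.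
     alt6 u v w (axis i 1) (axis j 1) (axis k 1) * T $ (i, j, k))"

text \<open>Up to a scalar, Hitchin's map \<open>V\<^sup>* \<rightarrow> \<and>\<^sup>5V = V\<^sup>* \<otimes> \<and>\<^sup>6V\<close>, \<open>\<xi> \<mapsto> \<iota>\<^sub>\<xi>T \<and> T\<close>.\<close>

definition hitchin :: "'a::field ^ (6 \<times> 6 \<times> 6) \<Rightarrow> 'a ^ 6 ^ 6" where
  "hitchin T = (\<chi> a b. \<Sum>c\<in>UNIV. \<Sum>d\<in>UNIV. star T (axis a 1) (axis c 1) (axis d 1) * T $ (b, c, d))"

text \<open>On trivectors the trace of the matrix itself is a multiple of \<open>T \<and> T\<close>,
  which vanishes in odd degree; hence the square.\<close>

definition quartic :: "'a::field ^ (6 \<times> 6 \<times> 6) \<Rightarrow> 'a" where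
  "quartic T = trace (hitchin T ** hitchin T)"

lemma matrix_mult_axis: "g *v axis j 1 = (\<Sum>i\<in>UNIV. g $ i $ j *s axis i 1)"
  for g :: "'a::field ^ 'n ^ 'm"
  by (simp add: vec_eq_iff matrix_vector_mult_def axis_def if_distrib cong: if_cong)

text \<open>Gathering a block of sums into one sum over a product type lets whole blocks be
  exchanged by a single \<open>sum.swap\<close>.\<close>

lemma triple_sum_eq:
  "(\<Sum>e\<in>UNIV. \<Sum>f\<in>UNIV. \<Sum>g\<in>UNIV. h e f g) = (\<Sum>t\<in>UNIV. h (fst t) (fst (snd t)) (snd (snd t)))"
  for h :: "6 \<Rightarrow> 6 \<Rightarrow> 6 \<Rightarrow> 'a::comm_monoid_add"
  by (simp add: sum.cartesian_product case_prod_beta)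

lemma double_sum_eq:
  "(\<Sum>e\<in>UNIV. \<Sum>f\<in>UNIV. h e f) = (\<Sum>t\<in>UNIV. h (fst t) (snd t))"
  for h :: "6 \<Rightarrow> 6 \<Rightarrow> 'a::comm_monoid_add"
  by (simp add: sum.cartesian_product case_prod_beta)

lemma double_triple_sum_swap:
  "(\<Sum>c\<in>UNIV. \<Sum>d\<in>UNIV. \<Sum>r\<in>UNIV. \<Sum>p\<in>UNIV. \<Sum>q\<in>UNIV. h c d r p q) =
   (\<Sum>r\<in>UNIV. \<Sum>p\<in>UNIV. \<Sum>q\<in>UNIV. \<Sum>c\<in>UNIV. \<Sum>d\<in>UNIV. h c d r p q)"
  for h :: "6 \<Rightarrow> 6 \<Rightarrow> 6 \<Rightarrow> 6 \<Rightarrow> 6 \<Rightarrow> 'a::comm_monoid_add"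
proof -
  have "(\<Sum>c\<in>UNIV. \<Sum>d\<in>UNIV. \<Sum>r\<in>UNIV. \<Sum>p\<in>UNIV. \<Sum>q\<in>UNIV. h c d r p q) =
      (\<Sum>u\<in>UNIV. \<Sum>t\<in>UNIV. h (fst u) (snd u) (fst t) (fst (snd t)) (snd (snd t)))"
    unfolding triple_sum_eq [where h = "h c d" for c d] by (rule double_sum_eq)
  also have "\<dots> = (\<Sum>t\<in>UNIV. \<Sum>u\<in>UNIV. h (fst u) (snd u) (fst t) (fst (snd t)) (snd (snd t)))"
    by (rule sum.swap)
  also have "\<dots> = (\<Sum>r\<in>UNIV. \<Sum>p\<in>UNIV. \<Sum>q\<in>UNIV. \<Sum>c\<in>UNIV. \<Sum>d\<in>UNIV. h c d r p q)"
    unfolding double_sum_eq [where h = "\<lambda>c d. h c d r p q" for r p q]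
    by (rule triple_sum_eq [symmetric])
  finally show ?thesis .
qed

text \<open>\<open>star\<close> is a coefficient in top degree, where \<open>ext3 g\<close> and
  \<open>g\<close> act through the determinant.\<close>

lemma star_ext3: "star (ext3 g T) (g *v u) (g *v v) (g *v w) = det g * star T u v w"
proof -
  let ?A = "\<lambda>i j k. alt6 (g *v u) (g *v v) (g *v w) (axis i 1) (axis j 1) (axis k 1)"
  have B: "det g * alt6 u v w (axis p 1) (axis q 1) (axis r 1) =
      (\<Sum>i\<in>UNIV. \<Sum>j\<in>UNIV. \<Sum>k\<in>UNIV. ?A i j k * (g$i$p * g$j$q * g$k$r))" for p q r
    unfolding alt6_matrix_mult [symmetric]
    unfolding matrix_mult_axis [of g p] alt6_sum
    unfolding matrix_mult_axis [of g q] alt6_sum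
    unfolding matrix_mult_axis [of g r] alt6_sum sum_distrib_left
    by (simp only: ac_simps)
  have "star (ext3 g T) (g *v u) (g *v v) (g *v w) =
      (\<Sum>i\<in>UNIV. \<Sum>j\<in>UNIV. \<Sum>k\<in>UNIV. \<Sum>p\<in>UNIV. \<Sum>q\<in>UNIV. \<Sum>r\<in>UNIV.
        ?A i j k * (g$i$p * g$j$q * g$k$r) * T $ (p, q, r))"
    by (simp add: star_def ext3_def sum_distrib_left mult.assoc)
  also have "\<dots> = (\<Sum>p\<in>UNIV. \<Sum>q\<in>UNIV. \<Sum>r\<in>UNIV. \<Sum>i\<in>UNIV. \<Sum>j\<in>UNIV. \<Sum>k\<in>UNIV.
        ?A i j k * (g$i$p * g$j$q * g$k$r) * T $ (p, q, r))"
    unfolding triple_sum_eq by (rule sum.swap)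
  also have "\<dots> = (\<Sum>p\<in>UNIV. \<Sum>q\<in>UNIV. \<Sum>r\<in>UNIV.
        det g * alt6 u v w (axis p 1) (axis q 1) (axis r 1) * T $ (p, q, r))"
    by (simp only: sum_distrib_right [symmetric] B)
  also have "\<dots> = det g * star T u v w"
    by (simp only: star_def sum_distrib_left mult.assoc)
  finally show ?thesis .
qed

lemma star_eq:
  "star T u v w = (\<Sum>t\<in>UNIV. alt6 u v w (axis (fst t) 1) (axis (fst (snd t)) 1)
     (axis (snd (snd t)) 1) * T $ t)"
  unfolding star_def triple_sum_eq by simp

lemma star_linear:
  "star T u (\<Sum>j\<in>UNIV. c j *s a j) w = (\<Sum>j\<in>UNIV. c j * star T u (a j) w)"
  "star T u v (\<Sum>j\<in>UNIV. c j *s a j) = (\<Sum>j\<in>UNIV. c j * star T u v (a j))"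
  "star T (\<Sum>j\<in>UNIV. c j *s a j) v w = (\<Sum>j\<in>UNIV. c j * star T (a j) v w)"
  for c :: "6 \<Rightarrow> 'a::field"
  unfolding star_eq alt6_sum sum_distrib_left sum_distrib_right mult.assoc
  by (rule sum.swap)+

text \<open>One factor \<open>T\<close> enters through \<open>star\<close>, which contributes
  \<open>det g\<close> and absorbs \<open>g\<close> into its arguments; the other is transformed by
  \<open>ext3 g\<close> directly. Multiplying by \<open>transpose g\<close> keeps inverses out of
  the identity.\<close>

lemma hitchin_ext3:
  "transpose g ** hitchin (ext3 g T) = (\<chi> i j. det g * (hitchin T ** transpose g) $ i $ j)"
proof -
  have "(transpose g ** hitchin (ext3 g T)) $ a $ b = det g * (hitchin T ** transpose g) $ a $ b"
    for a b
  proof -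
    let ?S = "\<lambda>c d. star (ext3 g T) (g *v axis a 1) (axis c 1) (axis d 1)"
    have S: "?S c d = (\<Sum>i\<in>UNIV. g$i$a * star (ext3 g T) (axis i 1) (axis c 1) (axis d 1))" for c d
      unfolding matrix_mult_axis star_linear ..
    have E: "ext3 g T $ (b, c, d) =
      (\<Sum>r\<in>UNIV. \<Sum>p\<in>UNIV. \<Sum>q\<in>UNIV. g$c$p * g$d$q * (g$b$r * T $ (r, p, q)))" for c d
      by (simp add: ext3_def ac_simps)
    have B: "det g * star T (axis a 1) (axis p 1) (axis q 1) =
      (\<Sum>c\<in>UNIV. \<Sum>d\<in>UNIV. ?S c d * (g$c$p * g$d$q))" for p q
      unfolding star_ext3 [symmetric]
      unfolding matrix_mult_axis [of g p] star_linear(1)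
      unfolding matrix_mult_axis [of g q] star_linear(2) sum_distrib_left
      by (simp only: ac_simps)
    have "(transpose g ** hitchin (ext3 g T)) $ a $ b = (\<Sum>i\<in>UNIV. \<Sum>c\<in>UNIV. \<Sum>d\<in>UNIV.
       g$i$a * star (ext3 g T) (axis i 1) (axis c 1) (axis d 1) * ext3 g T $ (b, c, d))"
      by (simp add: matrix_matrix_mult_def transpose_def hitchin_def sum_distrib_left mult.assoc)
    also have "\<dots> = (\<Sum>c\<in>UNIV. \<Sum>d\<in>UNIV. ?S c d * ext3 g T $ (b, c, d))"
      unfolding double_sum_eq unfolding S sum_distrib_right by (rule sum.swap)
    also have "\<dots> = (\<Sum>c\<in>UNIV. \<Sum>d\<in>UNIV. \<Sum>r\<in>UNIV. \<Sum>p\<in>UNIV. \<Sum>q\<in>UNIV.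
        ?S c d * (g$c$p * g$d$q) * (g$b$r * T $ (r, p, q)))"
      unfolding E sum_distrib_left by (simp only: ac_simps)
    also have "\<dots> = (\<Sum>r\<in>UNIV. \<Sum>p\<in>UNIV. \<Sum>q\<in>UNIV. \<Sum>c\<in>UNIV. \<Sum>d\<in>UNIV.
        ?S c d * (g$c$p * g$d$q) * (g$b$r * T $ (r, p, q)))"
      by (rule double_triple_sum_swap)
    also have "\<dots> = (\<Sum>r\<in>UNIV. \<Sum>p\<in>UNIV. \<Sum>q\<in>UNIV.
        det g * star T (axis a 1) (axis p 1) (axis q 1) * (g$b$r * T $ (r, p, q)))"
      by (simp only: sum_distrib_right [symmetric] B)
    also have "\<dots> = det g * (hitchin T ** transpose g) $ a $ b"
      by (simp add: matrix_matrix_mult_def transpose_def hitchin_def sum_distrib_left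
          sum_distrib_right ac_simps)
    finally show ?thesis .
  qed
  then show ?thesis by (simp add: vec_eq_iff)
qed

text \<open>By \<open>hitchin_ext3\<close> the new matrix is \<open>det g\<close> times a conjugate
  of the old one, and conjugation does not change the trace of the square.\<close>

lemma quartic_ext3:
  fixes g :: "'a::field ^ 6 ^ 6"
  assumes "invertible g"
  shows "quartic (ext3 g T) = (det g)\<^sup>2 * quartic T"
proof -
  let ?H = "hitchin T" and ?H' = "hitchin (ext3 g T)" and ?t = "transpose g"
  let ?D = "mat (det g) :: 'a ^ 6 ^ 6"
  obtain h where h: "g ** h = mat 1" "h ** g = mat 1"
    using assms unfolding invertible_def by blast
  let ?u = "transpose h"
  have u: "?t ** ?u = mat 1" "?u ** ?t = mat 1"
    using h by (metis matrix_transpose_mul transpose_mat)+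
  have D: "(\<chi> i j. det g * M $ i $ j) = ?D ** M" for M :: "'a ^ 6 ^ 6"
    by (simp add: vec_eq_iff matrix_matrix_mult_def mat_def if_distrib if_distribR cong: if_cong)
  have Dc: "M ** ?D = ?D ** M" for M :: "'a ^ 6 ^ 6"
    by (simp add: vec_eq_iff matrix_matrix_mult_def mat_def if_distrib if_distribR mult.commute
        cong: if_cong)
  have "?H' = ?u ** (?t ** ?H')" by (simp add: matrix_mul_assoc u)
  also have "\<dots> = ?u ** (?D ** (?H ** ?t))" by (simp only: hitchin_ext3 D)
  also have "\<dots> = ?D ** (?u ** ?H ** ?t)" by (metis Dc matrix_mul_assoc)
  finally have H': "?H' = ?D ** (?u ** ?H ** ?t)" .
  have "?H' ** ?H' = ?D ** (?u ** ?H ** ?t ** ?D) ** (?u ** ?H ** ?t)"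
    unfolding H' by (simp only: matrix_mul_assoc)
  also have "\<dots> = ?D ** (?D ** (?u ** ?H ** (?t ** ?u) ** ?H ** ?t))"
    unfolding Dc by (simp only: matrix_mul_assoc)
  finally have "?H' ** ?H' = ?D ** (?D ** (?u ** ?H ** (?t ** ?u) ** ?H ** ?t))" .
  then have "trace (?H' ** ?H') = (det g)\<^sup>2 * trace (?u ** (?H ** ?H) ** ?t)"
    unfolding D [symmetric] u(1)
    by (simp add: trace_def sum_distrib_left power2_eq_square mult.assoc matrix_mul_assoc)
  also have "trace (?u ** (?H ** ?H) ** ?t) = trace (?t ** (?u ** (?H ** ?H)))"
    by (rule trace_mul_sym)
  also have "\<dots> = trace (?H ** ?H)" by (simp add: matrix_mul_assoc u)
  finally show ?thesis by (simp add: quartic_def)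
qed

section \<open>Coordinates on the primitive trivectors\<close>

text \<open>These facts let the sorting rules below fire: the swaps are conditional on a strict
  order of indices, so rewriting ends with increasing indices.\<close>

lemma less_6:
  "(0::6) < 1" "(0::6) < 2" "(0::6) < 3" "(0::6) < 4" "(0::6) < 5" "(1::6) < 2" "(1::6) < 3"
  "(1::6) < 4" "(1::6) < 5" "(2::6) < 3" "(2::6) < 4" "(2::6) < 5" "(3::6) < 4" "(3::6) < 5"
  "(4::6) < 5"
  by (simp_all add: less_bit0_def bit0.Rep_numeral bit0.Rep_0 bit0.Rep_1)

lemma trivector_sort:
  assumes "T \<in> trivectors"
  shows "T $ (i, i, k) = 0" "T $ (i, k, i) = 0" "T $ (k, i, i) = 0"
    "j < i \<Longrightarrow> T $ (i, j, k) = - T $ (j, i, k)" "j < i \<Longrightarrow> T $ (k, i, j) = - T $ (k, j, i)"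
  using assms unfolding trivectors_def by blast+

lemma subspace_trivectors: "vec.subspace (trivectors :: ('a::field ^ (6 \<times> 6 \<times> 6)) set)"
proof (rule vec.subspaceI)
  show "(0 :: 'a ^ (6 \<times> 6 \<times> 6)) \<in> trivectors" by (simp add: trivectors_def)
next
  fix x y :: "'a ^ (6 \<times> 6 \<times> 6)"
  assume x: "x \<in> trivectors" and y: "y \<in> trivectors"
  show "x + y \<in> trivectors"
    unfolding trivectors_def mem_Collect_eq
  proof (intro allI)
    fix i j k
    show "(x + y) $ (i, i, k) = 0 \<and> (x + y) $ (i, k, i) = 0 \<and> (x + y) $ (k, i, i) = 0 \<and>
      (x + y) $ (j, i, k) = - (x + y) $ (i, j, k) \<and> (x + y) $ (i, k, j) = - (x + y) $ (i, j, k)"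
      using x [unfolded trivectors_def mem_Collect_eq, rule_format, where i = i and j = j and k = k]
        y [unfolded trivectors_def mem_Collect_eq, rule_format, where i = i and j = j and k = k]
      by simp
  qed
next
  fix c and x :: "'a ^ (6 \<times> 6 \<times> 6)"
  assume x: "x \<in> trivectors"
  show "c *s x \<in> trivectors"
    unfolding trivectors_def mem_Collect_eq
  proof (intro allI)
    fix i j k
    show "(c *s x) $ (i, i, k) = 0 \<and> (c *s x) $ (i, k, i) = 0 \<and> (c *s x) $ (k, i, i) = 0 \<and>
      (c *s x) $ (j, i, k) = - (c *s x) $ (i, j, k) \<and> (c *s x) $ (i, k, j) = - (c *s x) $ (i, j, k)"
      using x [unfolded trivectors_def mem_Collect_eq, rule_format, where i = i and j = j and k = k]
      by simp
  qed
qed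

lemma trivector_eqI:
  fixes S T :: "'a::field ^ (6 \<times> 6 \<times> 6)"
  assumes S: "S \<in> trivectors" and T: "T \<in> trivectors"
    and "S$(0,1,2) = T$(0,1,2)" "S$(0,1,3) = T$(0,1,3)" "S$(0,1,4) = T$(0,1,4)" "S$(0,1,5) = T$(0,1,5)"
    "S$(0,2,3) = T$(0,2,3)" "S$(0,2,4) = T$(0,2,4)" "S$(0,2,5) = T$(0,2,5)" "S$(0,3,4) = T$(0,3,4)"
    "S$(0,3,5) = T$(0,3,5)" "S$(0,4,5) = T$(0,4,5)" "S$(1,2,3) = T$(1,2,3)" "S$(1,2,4) = T$(1,2,4)"
    "S$(1,2,5) = T$(1,2,5)" "S$(1,3,4) = T$(1,3,4)" "S$(1,3,5) = T$(1,3,5)" "S$(1,4,5) = T$(1,4,5)"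
    "S$(2,3,4) = T$(2,3,4)" "S$(2,3,5) = T$(2,3,5)" "S$(2,4,5) = T$(2,4,5)" "S$(3,4,5) = T$(3,4,5)"
  shows "S = T"
  unfolding vec_eq_iff split_paired_All forall_6
  by (simp add: less_6 trivector_sort [OF S] trivector_sort [OF T] assms)

definition std_form :: "'a::field ^ 6 \<Rightarrow> 'a ^ 6 \<Rightarrow> 'a" where
  "std_form u v = u$0 * v$3 + u$1 * v$4 + u$2 * v$5 - u$3 * v$0 - u$4 * v$1 - u$5 * v$2"

text \<open>A symmetric \<open>3 \<times> 3\<close> matrix \<open>X\<close> is stored as \<open>(X\<^sub>1\<^sub>1, X\<^sub>2\<^sub>2, X\<^sub>3\<^sub>3, X\<^sub>1\<^sub>2, X\<^sub>1\<^sub>3, X\<^sub>2\<^sub>3)\<close>.\<close>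

definition sdet :: "'a::comm_ring_1 ^ 6 \<Rightarrow> 'a" where
  "sdet A = A$0 * A$1 * A$2 + 2 * A$3 * A$4 * A$5 - A$0 * (A$5)\<^sup>2 - A$1 * (A$4)\<^sup>2 - A$2 * (A$3)\<^sup>2"

definition sadj :: "'a::comm_ring_1 ^ 6 \<Rightarrow> 'a ^ 6" where
  "sadj A = vec6 (A$1 * A$2 - (A$5)\<^sup>2) (A$0 * A$2 - (A$4)\<^sup>2) (A$0 * A$1 - (A$3)\<^sup>2)
     (A$4 * A$5 - A$2 * A$3) (A$3 * A$5 - A$1 * A$4) (A$3 * A$4 - A$0 * A$5)"

definition strace :: "'a::comm_ring_1 ^ 6 \<Rightarrow> 'a ^ 6 \<Rightarrow> 'a" where
  "strace A B = A$0 * B$0 + A$1 * B$1 + A$2 * B$2 + 2 * (A$3 * B$3 + A$4 * B$4 + A$5 * B$5)"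

text \<open>The coordinates of \<open>\<and>\<^sup>3\<^sub>0 = K \<oplus> Sym\<^sub>3 \<oplus> Sym\<^sub>3 \<oplus> K\<close>, graded by the number of basis vectors
  \<open>f\<^sub>1, f\<^sub>2, f\<^sub>3\<close>; here \<open>e\<^sub>1, e\<^sub>2, e\<^sub>3, f\<^sub>1, f\<^sub>2, f\<^sub>3\<close> have the indices \<open>0, \<dots>, 5\<close>.\<close>

definition tri :: "'a::field \<Rightarrow> 'a ^ 6 \<Rightarrow> 'a ^ 6 \<Rightarrow> 'a \<Rightarrow> 'a ^ (6 \<times> 6 \<times> 6)" where
  "tri a A B d = (let W = (\<lambda>i j k. wedge3 (axis i 1) (axis j 1) (axis k 1)) in
     a *s W 0 1 2 + d *s W 3 4 5
     + A$0 *s W 3 1 2 + A$1 *s W 0 4 2 + A$2 *s W 0 1 5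
     + A$3 *s (W 4 1 2 + W 0 3 2) + A$4 *s (W 5 1 2 + W 0 1 3) + A$5 *s (W 0 5 2 + W 0 1 4)
     + B$0 *s W 0 4 5 + B$1 *s W 3 1 5 + B$2 *s W 3 4 2
     + B$3 *s (W 1 4 5 + W 3 0 5) + B$4 *s (W 2 4 5 + W 3 4 0) + B$5 *s (W 3 2 5 + W 3 4 1))"

lemma tri_in_trivectors: "tri a A B d \<in> trivectors"
  unfolding tri_def Let_def
  by (intro vec.subspace_add [OF subspace_trivectors] vec.subspace_scale [OF subspace_trivectors]
      wedge3_in_trivectors)

lemma tri_nth:
  "tri a A B d $ (0,1,2) = a" "tri a A B d $ (0,1,3) = A$4" "tri a A B d $ (0,1,4) = A$5"
  "tri a A B d $ (0,1,5) = A$2" "tri a A B d $ (0,2,3) = - (A$3)" "tri a A B d $ (0,2,4) = - (A$1)"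
  "tri a A B d $ (0,2,5) = - (A$5)" "tri a A B d $ (0,3,4) = B$4" "tri a A B d $ (0,3,5) = - (B$3)"
  "tri a A B d $ (0,4,5) = B$0" "tri a A B d $ (1,2,3) = A$0" "tri a A B d $ (1,2,4) = A$3"
  "tri a A B d $ (1,2,5) = A$4" "tri a A B d $ (1,3,4) = B$5" "tri a A B d $ (1,3,5) = - (B$1)"
  "tri a A B d $ (1,4,5) = B$3" "tri a A B d $ (2,3,4) = B$2" "tri a A B d $ (2,3,5) = - (B$5)"
  "tri a A B d $ (2,4,5) = B$4" "tri a A B d $ (3,4,5) = d"
  by (simp_all add: tri_def Let_def wedge3_def axis_def)

lemmas tri_coords = tri_nth trivector_sort [OF tri_in_trivectors] less_6

lemma contraction_std_form:
  assumes T: "T \<in> trivectors" and char: "(2::'a::field) \<noteq> 0"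
  shows "contraction std_form (T :: 'a ^ (6 \<times> 6 \<times> 6)) =
    (\<chi> k. T $ (0, 3, k) + T $ (1, 4, k) + T $ (2, 5, k))"
proof -
  have "T $ (3, 0, k) = - T $ (0, 3, k)" "T $ (4, 1, k) = - T $ (1, 4, k)"
    "T $ (5, 2, k) = - T $ (2, 5, k)" for k
    using T unfolding trivectors_def by blast+
  then show ?thesis
    using char by (simp add: contraction_def std_form_def sum_6 axis_def vec_eq_iff field_simps)
qed

lemma primitive_trivectors_std_form:
  assumes char: "(2::'a::field) \<noteq> 0"
  shows "primitive_trivectors (std_form :: 'a ^ 6 \<Rightarrow> _) = {tri a A B d | a A B d. True}"
proof (intro equalityI subsetI)
  fix T :: "'a ^ (6 \<times> 6 \<times> 6)"
  assume "T \<in> primitive_trivectors std_form"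
  then have T: "T \<in> trivectors" and "contraction std_form T = 0"
    by (auto simp: primitive_trivectors_def)
  then have c: "T $ (0, 3, k) + T $ (1, 4, k) + T $ (2, 5, k) = 0" for k
    using contraction_std_form [OF T char] by (simp add: vec_eq_iff)
  \<comment> \<open>The components of the contraction are six linear equations, which leave 14 of
    the 20 coordinates.\<close>
  have r: "T$(0,2,5) = - T$(0,1,4)" "T$(0,1,3) = T$(1,2,5)" "T$(0,2,3) = - T$(1,2,4)"
    "T$(2,3,5) = - T$(1,3,4)" "T$(0,3,4) = T$(2,4,5)" "T$(0,3,5) = - T$(1,4,5)"
    using c [of 0] c [of 1] c [of 2] c [of 3] c [of 4] c [of 5]
    by (simp_all add: trivector_sort [OF T] less_6 add_eq_0_iff add_eq_0_iff2)
     (metis add.inverse_inverse)+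
  have "T = tri (T$(0,1,2)) (vec6 (T$(1,2,3)) (- T$(0,2,4)) (T$(0,1,5)) (T$(1,2,4)) (T$(1,2,5)) (T$(0,1,4)))
      (vec6 (T$(0,4,5)) (- T$(1,3,5)) (T$(2,3,4)) (T$(1,4,5)) (T$(2,4,5)) (T$(1,3,4))) (T$(3,4,5))"
    by (intro trivector_eqI [OF T tri_in_trivectors]; simp add: tri_nth r)
  then show "T \<in> {tri a A B d | a A B d. True}" by blast
next
  fix T :: "'a ^ (6 \<times> 6 \<times> 6)"
  assume "T \<in> {tri a A B d | a A B d. True}"
  then obtain a A B d where "T = tri a A B d" by blast
  moreover have "contraction std_form (tri a A B d) = 0"
    by (rule vec6_eqI) (simp_all add: contraction_std_form [OF tri_in_trivectors char] tri_coords)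
  ultimately show "T \<in> primitive_trivectors std_form"
    by (simp add: primitive_trivectors_def tri_in_trivectors)
qed

section \<open>The quartic in symplectic coordinates\<close>

lemma eps_sort:
  "eps i i k l m n = 0" "eps i j i l m n = 0" "eps i j k i m n = 0" "eps i j k l i n = 0"
  "eps i j k l m i = 0" "eps i j j l m n = 0" "eps i j k j m n = 0" "eps i j k l j n = 0"
  "eps i j k l m j = 0" "eps i j k k m n = 0" "eps i j k l k n = 0" "eps i j k l m k = 0"
  "eps i j k l l n = 0" "eps i j k l m l = 0" "eps i j k l m m = 0"
  "j < i \<Longrightarrow> eps i j k l m n = - eps j i k l m n"
  "k < j \<Longrightarrow> eps i j k l m n = - eps i k j l m n"
  "l < k \<Longrightarrow> eps i j k l m n = - eps i j l k m n"
  "m < l \<Longrightarrow> eps i j k l m n = - eps i j k m l n"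
  "n < m \<Longrightarrow> eps i j k l m n = - eps i j k l n m"
  unfolding eps_def by (rule alt6_repeat alt6_swap)+

lemma eps_id: "eps 0 1 2 3 4 5 = (1 :: 'a::comm_ring_1)"
proof -
  have "vec6 (axis 0 1) (axis 1 1) (axis 2 1) (axis 3 1) (axis 4 1) (axis 5 1) = (mat 1 :: 'a ^ 6 ^ 6)"
    by (rule vec6_eqI; simp add: vec_eq_iff mat_def axis_def eq_commute)
  then show ?thesis
    by (simp add: eps_def alt6_def)
qed

lemma sadj_nth:
  "sadj A $ 0 = A$1 * A$2 - (A$5)\<^sup>2" "sadj A $ 1 = A$0 * A$2 - (A$4)\<^sup>2"
  "sadj A $ 2 = A$0 * A$1 - (A$3)\<^sup>2" "sadj A $ 3 = A$4 * A$5 - A$2 * A$3"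
  "sadj A $ 4 = A$3 * A$5 - A$1 * A$4" "sadj A $ 5 = A$3 * A$4 - A$0 * A$5"
  by (simp_all add: sadj_def)

lemma star_axis:
  "star T (axis a 1) (axis c 1) (axis d 1) =
    (\<Sum>i\<in>UNIV. \<Sum>j\<in>UNIV. \<Sum>k\<in>UNIV. eps a c d i j k * T $ (i, j, k))"
  by (simp add: star_def eps_def)

lemma star_sort:
  "star T u u w = 0" "star T u v u = 0" "star T v u u = 0"
  "j < i \<Longrightarrow> star T (axis i 1) (axis j 1) w = - star T (axis j 1) (axis i 1) w"
  "j < i \<Longrightarrow> star T u (axis i 1) (axis j 1) = - star T u (axis j 1) (axis i 1)"
proof -
  show "star T (axis i 1) (axis j 1) w = - star T (axis j 1) (axis i 1) w"
    unfolding star_def alt6_swap(1) [where v = "axis i 1" and u = "axis j 1"]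
    by (simp add: sum_negf)
  show "star T u (axis i 1) (axis j 1) = - star T u (axis j 1) (axis i 1)"
    unfolding star_def alt6_swap(2) [where w = "axis i 1" and v = "axis j 1"]
    by (simp add: sum_negf)
qed (simp_all add: star_def alt6_repeat)

lemma star_tri:
  fixes A B :: "'a::field ^ 6" and a d :: 'a
  defines "S \<equiv> \<lambda>i j k. star (tri a A B d) (axis i 1) (axis j 1) (axis k 1)"
  shows
    "S 0 1 2 = 6 * d" "S 0 1 3 = -6 * B$4" "S 0 1 4 = -6 * B$5" "S 0 1 5 = -6 * B$2"
    "S 0 2 3 = 6 * B$3" "S 0 2 4 = 6 * B$1" "S 0 2 5 = 6 * B$5" "S 0 3 4 = 6 * A$4"
    "S 0 3 5 = -6 * A$3" "S 0 4 5 = 6 * A$0" "S 1 2 3 = -6 * B$0" "S 1 2 4 = -6 * B$3"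
    "S 1 2 5 = -6 * B$4" "S 1 3 4 = 6 * A$5" "S 1 3 5 = -6 * A$1" "S 1 4 5 = 6 * A$3"
    "S 2 3 4 = 6 * A$2" "S 2 3 5 = -6 * A$5" "S 2 4 5 = 6 * A$4" "S 3 4 5 = -6 * a"
  unfolding S_def star_axis
  by (simp_all add: sum_6 eps_sort eps_id tri_coords)

text \<open>In 3 x 3 blocks: 24 AB + 12 s and 24 (dA - B#) in the upper row, 24 (A# - aB) and minus
  the transpose of the first block in the lower row. This is the shape of an element of the Lie
  algebra sp_6.\<close>

lemma hitchin_tri:
  fixes A B :: "'a::field ^ 6" and a d :: 'a
  defines "H \<equiv> hitchin (tri a A B d)" and "s \<equiv> a * d - strace A B"
  shows "H $ 0 $ 0 = 12 * (2 * (A$0 * B$0 + A$3 * B$3 + A$4 * B$4) + s)"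
    "H $ 0 $ 1 = 24 * (A$0 * B$3 + A$3 * B$1 + A$4 * B$5)"
    "H $ 0 $ 2 = 24 * (A$0 * B$4 + A$3 * B$5 + A$4 * B$2)"
    "H $ 1 $ 0 = 24 * (A$3 * B$0 + A$1 * B$3 + A$5 * B$4)"
    "H $ 1 $ 1 = 12 * (2 * (A$3 * B$3 + A$1 * B$1 + A$5 * B$5) + s)"
    "H $ 1 $ 2 = 24 * (A$3 * B$4 + A$1 * B$5 + A$5 * B$2)"
    "H $ 2 $ 0 = 24 * (A$4 * B$0 + A$5 * B$3 + A$2 * B$4)"
    "H $ 2 $ 1 = 24 * (A$4 * B$3 + A$5 * B$1 + A$2 * B$5)"
    "H $ 2 $ 2 = 12 * (2 * (A$4 * B$4 + A$5 * B$5 + A$2 * B$2) + s)"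
    "H $ 0 $ 3 = 24 * (d * A$0 - sadj B $ 0)"
    "H $ 0 $ 4 = 24 * (d * A$3 - sadj B $ 3)"
    "H $ 0 $ 5 = 24 * (d * A$4 - sadj B $ 4)"
    "H $ 1 $ 3 = 24 * (d * A$3 - sadj B $ 3)"
    "H $ 1 $ 4 = 24 * (d * A$1 - sadj B $ 1)"
    "H $ 1 $ 5 = 24 * (d * A$5 - sadj B $ 5)"
    "H $ 2 $ 3 = 24 * (d * A$4 - sadj B $ 4)"
    "H $ 2 $ 4 = 24 * (d * A$5 - sadj B $ 5)"
    "H $ 2 $ 5 = 24 * (d * A$2 - sadj B $ 2)"
    "H $ 3 $ 0 = 24 * (sadj A $ 0 - a * B$0)"
    "H $ 3 $ 1 = 24 * (sadj A $ 3 - a * B$3)"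
    "H $ 3 $ 2 = 24 * (sadj A $ 4 - a * B$4)"
    "H $ 4 $ 0 = 24 * (sadj A $ 3 - a * B$3)"
    "H $ 4 $ 1 = 24 * (sadj A $ 1 - a * B$1)"
    "H $ 4 $ 2 = 24 * (sadj A $ 5 - a * B$5)"
    "H $ 5 $ 0 = 24 * (sadj A $ 4 - a * B$4)"
    "H $ 5 $ 1 = 24 * (sadj A $ 5 - a * B$5)"
    "H $ 5 $ 2 = 24 * (sadj A $ 2 - a * B$2)"
    "H $ 3 $ 3 = - H $ 0 $ 0"
    "H $ 3 $ 4 = - H $ 1 $ 0"
    "H $ 3 $ 5 = - H $ 2 $ 0"
    "H $ 4 $ 3 = - H $ 0 $ 1"
    "H $ 4 $ 4 = - H $ 1 $ 1"
    "H $ 4 $ 5 = - H $ 2 $ 1"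
    "H $ 5 $ 3 = - H $ 0 $ 2"
    "H $ 5 $ 4 = - H $ 1 $ 2"
    "H $ 5 $ 5 = - H $ 2 $ 2"
  unfolding H_def s_def hitchin_def vec_lambda_beta sum_6
  by (simp_all add: star_sort star_tri tri_coords sadj_nth strace_def power2_eq_square algebra_simps)

lemma strace_sadj: "strace A (sadj A) = 3 * sdet A"
  unfolding sadj_nth strace_def sdet_def by (simp add: algebra_simps power2_eq_square)

text \<open>The left side is tr (AB)^2; use tr M^2 = (tr M)^2 - 2 tr M# with M = AB, and (AB)# = B#
  A#.\<close>

lemma trace_square_eq:
  fixes A B :: "'a::field ^ 6"
  shows "(A$0 * B$0 + A$3 * B$3 + A$4 * B$4)\<^sup>2 + (A$3 * B$3 + A$1 * B$1 + A$5 * B$5)\<^sup>2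
    + (A$4 * B$4 + A$5 * B$5 + A$2 * B$2)\<^sup>2
    + 2 * (A$0 * B$3 + A$3 * B$1 + A$4 * B$5) * (A$3 * B$0 + A$1 * B$3 + A$5 * B$4)
    + 2 * (A$0 * B$4 + A$3 * B$5 + A$4 * B$2) * (A$4 * B$0 + A$5 * B$3 + A$2 * B$4)
    + 2 * (A$3 * B$4 + A$1 * B$5 + A$5 * B$2) * (A$4 * B$3 + A$5 * B$1 + A$2 * B$5)
    = (strace A B)\<^sup>2 - 2 * strace (sadj A) (sadj B)"
  unfolding sadj_nth strace_def
  by (simp add: algebra_simps power2_eq_square)

lemma quartic_tri:
  "quartic (tri a A B d) = 864 * ((a * d - strace A B)\<^sup>2 + 4 * a * sdet B + 4 * d * sdet A
    - 4 * strace (sadj A) (sadj B))"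
proof -
  \<comment> \<open>The entries are named so that the trace is expanded with them as atoms.\<close>
  define s where "s = a * d - strace A B"
  define p00 where "p00 = A$0 * B$0 + A$3 * B$3 + A$4 * B$4"
  define p01 where "p01 = A$0 * B$3 + A$3 * B$1 + A$4 * B$5"
  define p02 where "p02 = A$0 * B$4 + A$3 * B$5 + A$4 * B$2"
  define p10 where "p10 = A$3 * B$0 + A$1 * B$3 + A$5 * B$4"
  define p11 where "p11 = A$3 * B$3 + A$1 * B$1 + A$5 * B$5"
  define p12 where "p12 = A$3 * B$4 + A$1 * B$5 + A$5 * B$2"
  define p20 where "p20 = A$4 * B$0 + A$5 * B$3 + A$2 * B$4"
  define p21 where "p21 = A$4 * B$3 + A$5 * B$1 + A$2 * B$5"
  define p22 where "p22 = A$4 * B$4 + A$5 * B$5 + A$2 * B$2"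
  define u v where "u = (\<lambda>k. d * A$k - sadj B $ k)" and "v = (\<lambda>k. sadj A $ k - a * B$k)"
  note defs = p00_def p01_def p02_def p10_def p11_def p12_def p20_def p21_def p22_def
  have H: "quartic (tri a A B d) =
      288 * (4 * (p00\<^sup>2 + p11\<^sup>2 + p22\<^sup>2 + 2 * p01 * p10 + 2 * p02 * p20 + 2 * p12 * p21)
        + 4 * s * (p00 + p11 + p22) + 3 * s\<^sup>2)
      + 1152 * (u 0 * v 0 + u 1 * v 1 + u 2 * v 2 + 2 * (u 3 * v 3 + u 4 * v 4 + u 5 * v 5))"
    unfolding quartic_def trace_def matrix_matrix_mult_def vec_lambda_beta sum_6 hitchin_tri
      defs [symmetric] s_def [symmetric]
    unfolding u_def [THEN fun_cong, symmetric] v_def [THEN fun_cong, symmetric]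
    by (simp add: algebra_simps power2_eq_square)
  have e1: "p00 + p11 + p22 = strace A B"
    by (simp add: defs strace_def)
  have e2: "p00\<^sup>2 + p11\<^sup>2 + p22\<^sup>2 + 2 * p01 * p10 + 2 * p02 * p20 + 2 * p12 * p21
      = (strace A B)\<^sup>2 - 2 * strace (sadj A) (sadj B)"
    unfolding defs by (rule trace_square_eq)
  have e3: "u 0 * v 0 + u 1 * v 1 + u 2 * v 2 + 2 * (u 3 * v 3 + u 4 * v 4 + u 5 * v 5)
      = d * strace A (sadj A) - a * d * strace A B - strace (sadj A) (sadj B) + a * strace B (sadj B)"
    by (simp add: u_def v_def strace_def algebra_simps)
  \<comment> \<open>As s + tr AB = ad, the terms tr AB (tr AB + s - ad) cancel; the rest has the
    common factor 864.\<close>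
  show ?thesis
    unfolding H e1 e2 e3 strace_sadj s_def by (simp add: algebra_simps power2_eq_square)
qed

lemma tri_add: "tri a A B d + tri a' A' B' d' = tri (a + a') (A + A') (B + B') (d + d')"
  by (rule trivector_eqI [OF vec.subspace_add [OF subspace_trivectors tri_in_trivectors
        tri_in_trivectors] tri_in_trivectors]) (simp_all add: tri_nth)

lemma tri_scale: "c *s tri a A B d = tri (c * a) (c *s A) (c *s B) (c * d)"
  by (rule trivector_eqI [OF vec.subspace_scale [OF subspace_trivectors tri_in_trivectors]
        tri_in_trivectors]) (simp_all add: tri_nth)

lemma tri_diff: "tri a A B d - tri a' A' B' d' = tri (a - a') (A - A') (B - B') (d - d')"
  using tri_add [of "a - a'" "A - A'" "B - B'" "d - d'" a' A' B' d'] by (simp add: algebra_simps)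

lemma tri_eq_iff: "tri a A B d = tri a' A' B' d' \<longleftrightarrow> a = a' \<and> A = A' \<and> B = B' \<and> d = d'"
proof
  assume e: "tri a A B d = tri a' A' B' d'"
  have n: "tri a A B d $ x = tri a' A' B' d' $ x" for x by (simp add: e)
  have "A = A'"
    by (rule vec6_eqI) (use n [of "(1,2,3)"] n [of "(0,2,4)"] n [of "(0,1,5)"] n [of "(1,2,4)"]
      n [of "(1,2,5)"] n [of "(0,1,4)"] in \<open>simp_all add: tri_nth\<close>)
  moreover have "B = B'"
    by (rule vec6_eqI) (use n [of "(0,4,5)"] n [of "(1,3,5)"] n [of "(2,3,4)"] n [of "(1,4,5)"]
      n [of "(2,4,5)"] n [of "(1,3,4)"] in \<open>simp_all add: tri_nth\<close>)
  ultimately show "a = a' \<and> A = A' \<and> B = B' \<and> d = d'"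
    using n [of "(0,1,2)"] n [of "(3,4,5)"] by (simp add: tri_nth)
qed simp

lemma tri_zero: "tri 0 0 0 0 = 0"
  using tri_scale [of 0 0 0 0 0] by simp

section \<open>The cubic form, its adjugate and the trace pairing\<close>

lemma sdet_minus: "sdet (- A) = - sdet A"
  by (simp add: sdet_def)

lemma sadj_minus: "sadj (- A) = sadj A"
  by (simp add: sadj_def)

lemma strace_minus: "strace (- A) B = - strace A B" "strace A (- B) = - strace A B"
  by (simp_all add: strace_def)

lemma strace_zero [simp]: "strace 0 B = 0" "strace A 0 = 0"
  by (simp_all add: strace_def)

lemma sdet_zero [simp]: "sdet 0 = 0"
  by (simp add: sdet_def)

lemma sadj_zero [simp]: "sadj 0 = 0"
  by (rule vec6_eqI) (simp_all add: sadj_nth)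

lemma sdet_scale: "sdet (c *s A) = c ^ 3 * sdet A"
  by (simp add: sdet_def algebra_simps power2_eq_square power3_eq_cube)

lemma strace_scale: "strace (c *s A) B = c * strace A B" "strace A (c *s B) = c * strace A B"
  by (simp_all add: strace_def algebra_simps)

lemma strace_commute: "strace A B = strace B A"
  by (simp add: strace_def algebra_simps)

text \<open>Only the parts of even degree in B survive. This polarises the cubic by values
  alone.\<close>

lemma sdet_add_sdet_diff: "sdet (A + B) + sdet (A - B) = 2 * sdet A + 2 * strace A (sadj B)"
  by (simp add: sdet_def strace_def sadj_nth algebra_simps power2_eq_square)

lemma strace_nondegenerate:
  fixes A :: "'a::field ^ 6"
  assumes char: "(2::'a) \<noteq> 0" and z: "\<And>B. strace A B = 0"
  shows "A = 0"
  using z [of "axis 0 1"] z [of "axis 1 1"] z [of "axis 2 1"] z [of "axis 3 1"] z [of "axis 4 1"]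
    z [of "axis 5 1"] char
  by (intro vec6_eqI) (simp_all add: strace_def axis_def)

text \<open>Adjugates span the symmetric matrices. The first three test matrices have a diagonal
  unit as adjugate; the other three produce one off-diagonal entry together with a diagonal one
  already shown to contribute zero.\<close>

lemma strace_sadj_nondegenerate:
  fixes A :: "'a::field ^ 6"
  assumes char: "(2::'a) \<noteq> 0" and z: "\<And>B. strace A (sadj B) = 0"
  shows "A = 0"
proof -
  have "A $ 0 = 0" using z [of "vec6 0 1 1 0 0 0"] by (simp add: strace_def sadj_nth)
  moreover have "A $ 1 = 0" using z [of "vec6 1 0 1 0 0 0"] by (simp add: strace_def sadj_nth)
  moreover have "A $ 2 = 0" using z [of "vec6 1 1 0 0 0 0"] by (simp add: strace_def sadj_nth)
  moreover have "A $ 3 = 0" using z [of "vec6 0 0 1 1 0 0"] \<open>A $ 2 = 0\<close> char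
    by (simp add: strace_def sadj_nth)
  moreover have "A $ 4 = 0" using z [of "vec6 0 1 0 0 1 0"] \<open>A $ 1 = 0\<close> char
    by (simp add: strace_def sadj_nth)
  moreover have "A $ 5 = 0" using z [of "vec6 1 0 0 0 0 1"] \<open>A $ 0 = 0\<close> char
    by (simp add: strace_def sadj_nth)
  ultimately show ?thesis by (intro vec6_eqI) simp_all
qed

text \<open>The cubic has no nonzero period: adding the identities for B and -B leaves tr(A B#) = 0
  for every B. Below this removes kernels and stray components.\<close>

lemma sdet_translation_invariant:
  fixes A :: "'a::field ^ 6"
  assumes char: "(2::'a) \<noteq> 0" and inv: "\<And>B. sdet (A + B) = sdet B"
  shows "A = 0"
proof (rule strace_sadj_nondegenerate [OF char])
  fix B
  have "sdet A = 0" using inv [of 0] by simp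
  moreover have "sdet (A - B) = - sdet B" using inv [of "- B"] by (simp add: sdet_minus)
  ultimately have "2 * strace A (sadj B) = 0"
    using sdet_add_sdet_diff [of A B] inv [of B] by simp
  then show "strace A (sadj B) = 0" using char by simp
qed

section \<open>Hessian and gradient of the quartic\<close>

text \<open>\<open>hess x y\<close> is twice the coefficient of \<open>t\<^sup>2\<close> in \<open>quartic (x + t y)\<close>, and \<open>grad y x\<close> is
  12 times the coefficient of \<open>t\<close> in \<open>quartic (y + t x)\<close>. Only values at \<open>K\<close>-points enter, so
  both are available over small finite fields.\<close>

definition hess :: "'a::field ^ (6 \<times> 6 \<times> 6) \<Rightarrow> 'a ^ (6 \<times> 6 \<times> 6) \<Rightarrow> 'a" where
  "hess x y = quartic (x + y) + quartic (x - y) - 2 * quartic x - 2 * quartic y"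

definition grad :: "'a::field ^ (6 \<times> 6 \<times> 6) \<Rightarrow> 'a ^ (6 \<times> 6 \<times> 6) \<Rightarrow> 'a" where
  "grad y x = 8 * (quartic (y + x) - quartic (y - x)) - (quartic (y + 2 *s x) - quartic (y - 2 *s x))"

text \<open>The Hessian at each extreme line is the square of the opposite extreme coordinate up to
  a factor, which makes these two coordinates visible to similitudes.\<close>

lemma hess_E: "hess (tri s 0 0 0) (tri a A B d) = 1728 * (s * d)\<^sup>2"
  by (simp add: hess_def tri_add tri_diff quartic_tri sdet_minus sadj_minus strace_minus
      algebra_simps power2_eq_square)

lemma hess_F: "hess (tri 0 0 0 s) (tri a A B d) = 1728 * (s * a)\<^sup>2"
  by (simp add: hess_def tri_add tri_diff quartic_tri sdet_minus sadj_minus strace_minus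
      algebra_simps power2_eq_square)

text \<open>For d = 0 the quartic is affine in a, with slope 864 times 4 det B; \<open>grad\<close>
  multiplies the slope by 12.\<close>

lemma grad_E: "grad (tri a A B 0) (tri s 0 0 0) = 41472 * s * sdet B"
  by (simp add: grad_def tri_scale tri_add tri_diff quartic_tri sdet_minus sadj_minus strace_minus
      algebra_simps power2_eq_square)

lemma grad_F: "grad (tri 0 A B d) (tri 0 0 0 s) = 41472 * s * sdet A"
  by (simp add: grad_def tri_scale tri_add tri_diff quartic_tri sdet_minus sadj_minus strace_minus
      algebra_simps power2_eq_square)

lemma hess_EB: "hess (tri a 0 B d) (tri 0 0 C 0) = 6912 * a * strace B (sadj C)"
proof -
  have "hess (tri a 0 B d) (tri 0 0 C 0) = 3456 * a * (sdet (B + C) + sdet (B - C) - 2 * sdet B)"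
    by (simp add: hess_def tri_add tri_diff quartic_tri sdet_minus sadj_minus strace_minus
        algebra_simps power2_eq_square)
  then show ?thesis by (simp add: sdet_add_sdet_diff)
qed

lemma hess_FA: "hess (tri a A 0 d) (tri 0 C 0 0) = 6912 * d * strace A (sadj C)"
proof -
  have "hess (tri a A 0 d) (tri 0 C 0 0) = 3456 * d * (sdet (A + C) + sdet (A - C) - 2 * sdet A)"
    by (simp add: hess_def tri_add tri_diff quartic_tri sdet_minus sadj_minus strace_minus
        algebra_simps power2_eq_square)
  then show ?thesis by (simp add: sdet_add_sdet_diff)
qed

lemma hess_EF: "hess (tri a 0 0 d) (tri 0 A B 0) = - 3456 * a * d * strace A B"
  by (simp add: hess_def tri_add tri_diff quartic_tri sdet_minus sadj_minus strace_minus
      algebra_simps power2_eq_square)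

lemma numeral_neq_0:
  assumes "(2::'a::field) \<noteq> 0" "(3::'a) \<noteq> 0"
  shows "(864::'a) \<noteq> 0" "(1728::'a) \<noteq> 0" "(3456::'a) \<noteq> 0" "(6912::'a) \<noteq> 0" "(41472::'a) \<noteq> 0"
    "(6::'a) \<noteq> 0"
proof -
  have "(864::'a) = 2 ^ 5 * 3 ^ 3" "(1728::'a) = 2 ^ 6 * 3 ^ 3" "(3456::'a) = 2 ^ 7 * 3 ^ 3"
    "(6912::'a) = 2 ^ 8 * 3 ^ 3" "(41472::'a) = 2 ^ 9 * 3 ^ 4" "(6::'a) = 2 * 3"
    by simp_all
  then show "(864::'a) \<noteq> 0" "(1728::'a) \<noteq> 0" "(3456::'a) \<noteq> 0" "(6912::'a) \<noteq> 0" "(41472::'a) \<noteq> 0"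
    "(6::'a) \<noteq> 0"
    using assms by (metis mult_eq_0_iff power_eq_0_iff)+
qed

text \<open>The quadratic form \<open>hess x\<close> vanishes only on its radical. For \<open>x \<noteq> 0\<close> this characterises
  the decomposable primitive trivectors (lemma \<open>rank_one_to_E\<close>), and it is invariant under
  similitudes of the quartic.\<close>

definition rank_one :: "'a::field ^ (6 \<times> 6 \<times> 6) \<Rightarrow> bool" where
  "rank_one x \<longleftrightarrow> (\<forall>y\<in>primitive_trivectors std_form. \<forall>z\<in>primitive_trivectors std_form.
     hess x y = 0 \<longrightarrow> hess x (y + z) = hess x z)"

section \<open>Similitudes of the quartic\<close>

lemma rank_oneD:
  assumes "rank_one x" "(2::'a::field) \<noteq> 0" "hess x (tri a A B d) = (0::'a)"
  shows "hess x (tri a A B d + tri a' A' B' d') = hess x (tri a' A' B' d')"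
  using assms unfolding rank_one_def primitive_trivectors_std_form [OF assms(2)] by blast

text \<open>The Hessian is a multiple of the square of a linear form, and such a form vanishes only
  on its radical.\<close>

lemma rank_one_E:
  assumes "(2::'a::field) \<noteq> 0" "(3::'a) \<noteq> 0"
  shows "rank_one (tri (s::'a) 0 0 0)" "rank_one (tri 0 0 0 (s::'a))"
  unfolding rank_one_def primitive_trivectors_std_form [OF assms(1)]
  using numeral_neq_0 [OF assms] by (auto simp: hess_E hess_F tri_add power2_eq_square algebra_simps)

text \<open>In each test pair the first matrix has adjugate zero. Two diagonal units isolate a
  diagonal entry of A; a diagonal and an off-diagonal unit isolate twice an off-diagonal
  entry.\<close>

lemma strace_sadj_combination:
  fixes A :: "'a::field ^ 6"
  assumes char: "(2::'a) \<noteq> 0"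
    and z: "\<And>B C. strace A (sadj B) = 0 \<Longrightarrow> strace A (sadj (B + C)) = strace A (sadj C)"
  shows "A = 0"
proof (rule vec6_eqI)
  show "A $ 0 = 0 $ 0" using z [of "axis 1 1" "axis 2 1"] by (simp add: strace_def sadj_nth axis_def)
  show "A $ 1 = 0 $ 1" using z [of "axis 0 1" "axis 2 1"] by (simp add: strace_def sadj_nth axis_def)
  show "A $ 2 = 0 $ 2" using z [of "axis 0 1" "axis 1 1"] by (simp add: strace_def sadj_nth axis_def)
  show "A $ 3 = 0 $ 3" using z [of "axis 2 1" "axis 3 1"] char
    by (simp add: strace_def sadj_nth axis_def)
  show "A $ 4 = 0 $ 4" using z [of "axis 1 1" "axis 4 1"] char
    by (simp add: strace_def sadj_nth axis_def)
  show "A $ 5 = 0 $ 5" using z [of "axis 0 1" "axis 5 1"] char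
    by (simp add: strace_def sadj_nth axis_def)
qed

text \<open>On the middle part the Hessian is ad times the pairing of the two copies of Sym_3. A
  nonzero vector in one copy is isotropic, but lies in the radical only if ad = 0.\<close>

lemma rank_one_EF:
  fixes a d :: "'a::field"
  assumes char: "(2::'a) \<noteq> 0" "(3::'a) \<noteq> 0" and r: "rank_one (tri a 0 0 d)"
  shows "a * d = 0"
proof -
  let ?A = "axis 0 1 :: 'a ^ 6"
  have "hess (tri a 0 0 d) (tri 0 ?A 0 0) = 0"
    by (simp add: hess_EF)
  from rank_oneD [OF r char(1) this, of 0 0 ?A 0] have "3456 * (a * d) = 0"
    by (simp add: hess_EF tri_add strace_def axis_def)
  then show ?thesis using numeral_neq_0 [OF char] by simp
qed

text \<open>Along the second Sym_3 the Hessian is a multiple of C -> tr(B C#), to which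
  \<open>strace_sadj_combination\<close> applies.\<close>

lemma rank_one_EB:
  fixes a d :: "'a::field"
  assumes char: "(2::'a) \<noteq> 0" "(3::'a) \<noteq> 0" and r: "rank_one (tri a 0 B d)" and a: "a \<noteq> 0"
  shows "B = 0 \<and> d = 0"
proof -
  have n: "6912 * a \<noteq> 0" using numeral_neq_0 [OF char] a by simp
  have "B = 0"
  proof (rule strace_sadj_combination [OF char(1)])
    fix C D assume "strace B (sadj C) = 0"
    then have "hess (tri a 0 B d) (tri 0 0 C 0) = 0" by (simp add: hess_EB)
    from rank_oneD [OF r char(1) this, of 0 0 D 0] show "strace B (sadj (C + D)) = strace B (sadj D)"
      using n by (simp add: hess_EB tri_add)
  qed
  then show ?thesis using rank_one_EF [OF char, of a d] r a by simp
qed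

lemma rank_one_FA:
  fixes a d :: "'a::field"
  assumes char: "(2::'a) \<noteq> 0" "(3::'a) \<noteq> 0" and r: "rank_one (tri a A 0 d)" and d: "d \<noteq> 0"
  shows "A = 0 \<and> a = 0"
proof -
  have n: "6912 * d \<noteq> 0" using numeral_neq_0 [OF char] d by simp
  have "A = 0"
  proof (rule strace_sadj_combination [OF char(1)])
    fix C D assume "strace A (sadj C) = 0"
    then have "hess (tri a A 0 d) (tri 0 C 0 0) = 0" by (simp add: hess_FA)
    from rank_oneD [OF r char(1) this, of 0 D 0 0] show "strace A (sadj (C + D)) = strace A (sadj D)"
      using n by (simp add: hess_FA tri_add)
  qed
  then show ?thesis using rank_one_EF [OF char, of a d] r d by simp
qed

text \<open>The free factor \<open>k\<close> makes the notion stable under composition with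
  \<open>c *s ext3 g\<close>, which scales the quartic by
  \<open>c ^ 4 * (det g)\<^sup>2\<close>.\<close>

definition similitude :: "('a::field ^ (6 \<times> 6 \<times> 6) \<Rightarrow> 'a ^ (6 \<times> 6 \<times> 6)) \<Rightarrow> 'a \<Rightarrow> bool" where
  "similitude \<phi> k \<longleftrightarrow> linear_endo_on (primitive_trivectors std_form) \<phi> \<and> k \<noteq> 0 \<and>
     (\<forall>x\<in>primitive_trivectors std_form. quartic (\<phi> x) = k * quartic x)"

text \<open>A projection of the whole array space onto the arrays \<open>tri a A B d\<close>.
  Composing with it turns a map that is linear only on these into a linear map on the whole space,
  to which dimension theory applies.\<close>

definition tri_proj :: "'a::field ^ (6 \<times> 6 \<times> 6) \<Rightarrow> 'a ^ (6 \<times> 6 \<times> 6)" where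
  "tri_proj T = tri (T$(0,1,2))
     (vec6 (T$(1,2,3)) (- T$(0,2,4)) (T$(0,1,5)) (T$(1,2,4)) (T$(1,2,5)) (T$(0,1,4)))
     (vec6 (T$(0,4,5)) (- T$(1,3,5)) (T$(2,3,4)) (T$(1,4,5)) (T$(2,4,5)) (T$(1,3,4))) (T$(3,4,5))"

lemma linear_tri_proj: "Vector_Spaces.linear (*s) (*s) tri_proj"
proof unfold_locales
  fix c and x y :: "'a::field ^ (6 \<times> 6 \<times> 6)"
  show "tri_proj (x + y) = tri_proj x + tri_proj y"
    unfolding tri_proj_def tri_add tri_eq_iff by (intro conjI vec6_eqI) simp_all
  show "tri_proj (c *s x) = c *s tri_proj x"
    unfolding tri_proj_def tri_scale tri_eq_iff by (intro conjI vec6_eqI) simp_all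
qed

lemma tri_proj_tri: "tri_proj (tri a A B d) = tri a A B d"
  unfolding tri_proj_def tri_eq_iff by (intro conjI vec6_eqI) (simp_all add: tri_nth)

context
  fixes \<phi> :: "'a::field ^ (6 \<times> 6 \<times> 6) \<Rightarrow> 'a ^ (6 \<times> 6 \<times> 6)" and k :: 'a
  assumes char: "(2::'a) \<noteq> 0" "(3::'a) \<noteq> 0" and sim: "similitude \<phi> k"
begin

lemma similitude_tri_ex: "\<exists>a' A' B' d'. \<phi> (tri a A B d) = tri a' A' B' d'"
  using sim unfolding similitude_def linear_endo_on_def primitive_trivectors_std_form [OF char(1)]
  by blast

lemma similitude_linear:
  "\<phi> (tri a A B d + tri a' A' B' d') = \<phi> (tri a A B d) + \<phi> (tri a' A' B' d')"
  "\<phi> (c *s tri a A B d) = c *s \<phi> (tri a A B d)"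
  using sim unfolding similitude_def linear_endo_on_def primitive_trivectors_std_form [OF char(1)]
  by blast+

lemma similitude_diff: "\<phi> (tri a A B d - tri a' A' B' d') = \<phi> (tri a A B d) - \<phi> (tri a' A' B' d')"
  using similitude_linear(1) [of "a - a'" "A - A'" "B - B'" "d - d'" a' A' B' d']
  by (simp add: tri_add tri_diff algebra_simps)

lemma similitude_quartic: "quartic (\<phi> (tri a A B d)) = k * quartic (tri a A B d)" "k \<noteq> 0"
  using sim unfolding similitude_def primitive_trivectors_std_form [OF char(1)] by blast+

lemma similitude_hess:
  "hess (\<phi> (tri a A B d)) (\<phi> (tri a' A' B' d')) = k * hess (tri a A B d) (tri a' A' B' d')"
  unfolding hess_def similitude_linear(1) [symmetric] similitude_diff [symmetric]
  unfolding tri_add tri_diff similitude_quartic by (simp add: algebra_simps)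

lemma similitude_grad:
  "grad (\<phi> (tri a A B d)) (\<phi> (tri a' A' B' d')) = k * grad (tri a A B d) (tri a' A' B' d')"
  unfolding grad_def similitude_linear(2) [symmetric] tri_scale
  unfolding similitude_linear(1) [symmetric] similitude_diff [symmetric]
  unfolding tri_add tri_diff similitude_quartic by (simp add: algebra_simps)

lemma similitude_zero: "\<phi> 0 = 0"
  using similitude_linear(2) [of 0 0 0 0 0] by (simp add: tri_scale tri_zero)

text \<open>A kernel vector is a period of the quartic, hence orthogonal to everything under
  \<open>hess\<close> and a period of \<open>grad\<close> in its first argument. The extreme lines
  then kill d and a, and the periods of the cubic B and A.\<close>

lemma similitude_kernel:
  assumes z: "\<phi> (tri a A B d) = 0"
  shows "tri a A B d = 0"
proof -
  have inv: "quartic (tri a A B d + tri a' A' B' d') = quartic (tri a' A' B' d')"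
    "quartic (tri a' A' B' d' - tri a A B d) = quartic (tri a' A' B' d')" for a' A' B' d'
    using similitude_quartic(1) [of "a + a'" "A + A'" "B + B'" "d + d'"]
      similitude_quartic(1) [of "a' - a" "A' - A" "B' - B" "d' - d"]
      similitude_quartic(1) [of a' A' B' d'] similitude_quartic(2)
    by (simp_all add: z tri_add [symmetric] tri_diff [symmetric] similitude_linear(1) similitude_diff)
  have q0: "quartic (0 :: 'a ^ (6 \<times> 6 \<times> 6)) = 0"
    using quartic_tri [of "0::'a" 0 0 0] by (simp add: tri_zero)
  then have "quartic (tri a A B d) = 0"
    using inv(1) [of 0 0 0 0] by (simp add: tri_zero)
  then have h: "hess (tri a' A' B' d') (tri a A B d) = 0" for a' A' B' d'
    unfolding hess_def add.commute [of "tri a' A' B' d'"] inv by simp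
  have d: "d = 0" using h [of 1 0 0 0] numeral_neq_0 [OF char] by (simp add: hess_E)
  have a: "a = 0" using h [of 0 0 0 1] numeral_neq_0 [OF char] by (simp add: hess_F)
  have "B = 0"
  proof (rule sdet_translation_invariant [OF char(1)])
    fix Y
    have "grad (tri a A B d + tri 0 0 Y 0) (tri 1 0 0 0) = grad (tri 0 0 Y 0) (tri 1 0 0 0)"
      unfolding grad_def tri_scale add_diff_eq [symmetric] add.assoc tri_diff [of 0 0 Y 0]
        tri_add [of 0 0 Y 0] inv by (simp add: tri_diff tri_add)
    then show "sdet (B + Y) = sdet Y"
      using numeral_neq_0 [OF char] unfolding tri_add a d by (simp add: grad_E)
  qed
  moreover have "A = 0"
  proof (rule sdet_translation_invariant [OF char(1)])
    fix Y
    have "grad (tri a A B d + tri 0 Y 0 0) (tri 0 0 0 1) = grad (tri 0 Y 0 0) (tri 0 0 0 1)"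
      unfolding grad_def tri_scale add_diff_eq [symmetric] add.assoc tri_diff [of 0 Y 0 0]
        tri_add [of 0 Y 0 0] inv by (simp add: tri_diff tri_add)
    then show "sdet (A + Y) = sdet Y"
      using numeral_neq_0 [OF char] unfolding tri_add a d by (simp add: grad_F)
  qed
  ultimately show ?thesis by (simp add: a d tri_zero)
qed

text \<open>An injective linear endomorphism of a finite-dimensional space is onto.\<close>

lemma similitude_surj: "\<exists>a' A' B' d'. \<phi> (tri a' A' B' d') = tri a A B d"
proof -
  let ?W = "range tri_proj :: ('a ^ (6 \<times> 6 \<times> 6)) set" and ?f = "\<lambda>T. \<phi> (tri_proj T)"
  interpret P: Vector_Spaces.linear "(*s)" "(*s)" "tri_proj :: _ \<Rightarrow> 'a ^ (6 \<times> 6 \<times> 6)"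
    by (rule linear_tri_proj)
  have t: "\<exists>a A B d. tri_proj T = tri a A B d" for T :: "'a ^ (6 \<times> 6 \<times> 6)"
    unfolding tri_proj_def by blast
  have W: "x \<in> ?W \<longleftrightarrow> (\<exists>a A B d. x = tri a A B d)" for x
  proof
    show "\<exists>a A B d. x = tri a A B d" if "x \<in> ?W" using that t by blast
    assume "\<exists>a A B d. x = tri a A B d"
    then have "x = tri_proj x" by (auto simp: tri_proj_tri)
    then show "x \<in> ?W" by (rule range_eqI)
  qed
  have sub: "vec.subspace ?W" using P.subspace_image [OF vec.subspace_UNIV] .
  have f: "Vector_Spaces.linear (*s) (*s) ?f"
  proof unfold_locales
    fix c and x y :: "'a ^ (6 \<times> 6 \<times> 6)"
    show "?f (x + y) = ?f x + ?f y" unfolding P.add by (metis t similitude_linear(1))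
    show "?f (c *s x) = c *s ?f x" unfolding P.scale by (metis t similitude_linear(2))
  qed
  have inj: "inj_on ?f ?W"
  proof (rule inj_onI)
    fix x y assume x: "x \<in> ?W" and y: "y \<in> ?W" and e: "?f x = ?f y"
    obtain a A B d a' A' B' d' where x: "x = tri a A B d" and y: "y = tri a' A' B' d'"
      using x [unfolded W] y [unfolded W] by blast
    have "\<phi> (tri (a - a') (A - A') (B - B') (d - d')) = 0"
      using e unfolding x y tri_proj_tri tri_diff [symmetric] similitude_diff by simp
    from similitude_kernel [OF this] show "x = y" unfolding x y tri_diff [symmetric] by simp
  qed
  have "?f ` ?W \<subseteq> ?W"
  proof (rule image_subsetI)
    fix x :: "'a ^ (6 \<times> 6 \<times> 6)"
    obtain a A B d where "tri_proj x = tri a A B d" using t by blast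
    then show "?f x \<in> ?W" unfolding W using similitude_tri_ex by simp
  qed
  moreover have "vec.subspace (?f ` ?W)" by (rule vec.linear_subspace_image [OF f sub])
  moreover have "vec.dim (?f ` ?W) = vec.dim ?W"
    using vec.dim_image_eq [OF f] inj sub by (metis vec.span_eq_iff)
  ultimately have "?f ` ?W = ?W"
    using vec.subspace_dim_equal [OF _ sub] by (metis order_refl)
  moreover have "tri a A B d \<in> ?W" unfolding W by blast
  ultimately obtain x where "?f x = tri a A B d" by (metis (no_types, lifting) imageE)
  then show ?thesis using t [of x] by metis
qed

text \<open>\<open>rank_one\<close> quantifies over all primitive trivectors; surjectivity writes
  them as images.\<close>

lemma similitude_rank_one:
  assumes r: "rank_one (tri a A B d)"
  shows "rank_one (\<phi> (tri a A B d))"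
  unfolding rank_one_def primitive_trivectors_std_form [OF char(1)]
proof (intro ballI impI)
  fix y z :: "'a ^ (6 \<times> 6 \<times> 6)"
  assume y: "y \<in> {tri a A B d |a A B d. True}" and z: "z \<in> {tri a A B d |a A B d. True}"
    and h: "hess (\<phi> (tri a A B d)) y = 0"
  obtain a1 A1 B1 d1 a2 A2 B2 d2
    where y: "y = \<phi> (tri a1 A1 B1 d1)" and z: "z = \<phi> (tri a2 A2 B2 d2)"
    using y z similitude_surj unfolding mem_Collect_eq by metis
  show "hess (\<phi> (tri a A B d)) (y + z) = hess (\<phi> (tri a A B d)) z"
    using h similitude_quartic(2)
      rank_oneD [OF r char(1), of a1 A1 B1 d1 a2 A2 B2 d2]
    unfolding y z similitude_linear(1) [symmetric]
    by (simp add: tri_add similitude_hess)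
qed

end

section \<open>Symplectic similitudes\<close>

lemma ext3_add: "ext3 g (x + y) = ext3 g x + ext3 g y"
  and ext3_scale: "ext3 g (c *s x) = c *s ext3 g x"
proof -
  interpret L: Vector_Spaces.linear "(*s)" "(*s)" "ext3 g" by (rule linear_ext3)
  show "ext3 g (x + y) = ext3 g x + ext3 g y" "ext3 g (c *s x) = c *s ext3 g x"
    by (rule L.add L.scale)+
qed

lemma trivectors_linear_eq:
  fixes p q :: "'a::field ^ (6 \<times> 6 \<times> 6) \<Rightarrow> 'a ^ 'n"
  assumes char: "(2::'a) \<noteq> 0" "(3::'a) \<noteq> 0"
    and "Vector_Spaces.linear (*s) (*s) p" "Vector_Spaces.linear (*s) (*s) q"
    and "\<And>u v w. p (wedge3 u v w) = q (wedge3 u v w)" and "T \<in> trivectors"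
  shows "p T = q T"
proof (rule vec.linear_eq_on [OF assms(3,4)])
  show "T \<in> vec.span {wedge3 u v w |u v w. True}"
    using assms(6) trivectors_eq_span [OF char] by simp
qed (use assms(5) in auto)

lemma ext3_in_trivectors:
  assumes char: "(2::'a::field) \<noteq> 0" "(3::'a) \<noteq> 0" and T: "(T :: 'a ^ (6 \<times> 6 \<times> 6)) \<in> trivectors"
  shows "ext3 g T \<in> trivectors"
proof -
  have "T \<in> vec.span {wedge3 u v w |u v w. True}"
    using T trivectors_eq_span [OF char] by simp
  then show ?thesis
  proof (induction rule: vec.span_induct_alt)
    case base
    show ?case using ext3_scale [of g 0 0] by (simp add: trivectors_def)
  next
    case (step c x y)
    then show ?case
      by (auto simp: ext3_add ext3_scale ext3_wedge3 intro!: vec.subspace_add [OF subspace_trivectors]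
          vec.subspace_scale [OF subspace_trivectors] wedge3_in_trivectors)
  qed
qed

lemma ext3_mult:
  assumes char: "(2::'a::field) \<noteq> 0" "(3::'a) \<noteq> 0" and T: "(T :: 'a ^ (6 \<times> 6 \<times> 6)) \<in> trivectors"
  shows "ext3 (g ** h) T = ext3 g (ext3 h T)"
proof (rule trivectors_linear_eq [OF char linear_ext3 _ _ T])
  show "Vector_Spaces.linear (*s) (*s) (\<lambda>T. ext3 g (ext3 h T))"
    by unfold_locales (simp_all add: ext3_add ext3_scale)
qed (simp add: ext3_wedge3 matrix_vector_mul_assoc)

lemma ext3_mat_1:
  assumes char: "(2::'a::field) \<noteq> 0" "(3::'a) \<noteq> 0" and T: "(T :: 'a ^ (6 \<times> 6 \<times> 6)) \<in> trivectors"
  shows "ext3 (mat 1) T = T"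
  by (rule trivectors_linear_eq [OF char linear_ext3 vec.linear_ident _ T]) (simp add: ext3_wedge3)

text \<open>Two forms are allowed so that the lemma covers both the elements of \<open>GSp\<close>
  and the change to a symplectic basis.\<close>

lemma contraction_ext3:
  assumes char: "(2::'a::field) \<noteq> 0" "(3::'a) \<noteq> 0"
    and b: "symplectic_form b" and b': "symplectic_form b'"
    and h: "\<And>u v. b (h *v u) (h *v v) = m * b' u v" and T: "(T :: 'a ^ (6 \<times> 6 \<times> 6)) \<in> trivectors"
  shows "contraction b (ext3 h T) = m *s (h *v contraction b' T)"
proof (rule trivectors_linear_eq [OF char _ _ _ T])
  interpret C: Vector_Spaces.linear "(*s)" "(*s)" "contraction b" by (rule linear_contraction)
  interpret C': Vector_Spaces.linear "(*s)" "(*s)" "contraction b'" by (rule linear_contraction)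
  show "Vector_Spaces.linear (*s) (*s) (\<lambda>T. contraction b (ext3 h T))"
    by unfold_locales (simp_all add: ext3_add ext3_scale C.add C.scale)
  show "Vector_Spaces.linear (*s) (*s) (\<lambda>T. m *s (h *v contraction b' T))"
    by unfold_locales (simp_all add: C'.add C'.scale vec.add vec.scale vec.scale_right_distrib mult.commute)
  show "contraction b (ext3 h (wedge3 u v w)) = m *s (h *v contraction b' (wedge3 u v w))" for u v w
    by (simp add: ext3_wedge3 contraction_wedge3 [OF b char(1)] contraction_wedge3 [OF b' char(1)] h
        vec.add vec.diff vec.scale vec.scale_right_distrib vec.scale_right_diff_distrib)
qed

lemma ext3_primitive_trivectors:
  assumes char: "(2::'a::field) \<noteq> 0" "(3::'a) \<noteq> 0"
    and b: "symplectic_form b" and b': "symplectic_form b'"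
    and h: "\<And>u v. b (h *v u) (h *v v) = m * b' u v"
    and T: "(T :: 'a ^ (6 \<times> 6 \<times> 6)) \<in> primitive_trivectors b'"
  shows "ext3 h T \<in> primitive_trivectors b"
  using T contraction_ext3 [OF char b b' h] ext3_in_trivectors [OF char]
  by (simp add: primitive_trivectors_def)

lemma std_form_axis:
  "std_form u (axis 3 1) = u $ 0" "std_form u (axis 4 1) = u $ 1" "std_form u (axis 5 1) = u $ 2"
  "std_form u (axis 0 1) = - u $ 3" "std_form u (axis 1 1) = - u $ 4" "std_form u (axis 2 1) = - u $ 5"
  by (simp_all add: std_form_def axis_def)

lemma std_form_nondegenerate:
  assumes "\<And>v. std_form u v = 0"
  shows "u = 0"
  using assms [of "axis 0 1"] assms [of "axis 1 1"] assms [of "axis 2 1"] assms [of "axis 3 1"]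
    assms [of "axis 4 1"] assms [of "axis 5 1"]
  by (intro vec6_eqI) (simp_all add: std_form_axis)

lemma symplectic_std_form: "symplectic_form (std_form :: 'a::field ^ 6 \<Rightarrow> _)"
  unfolding symplectic_form_def
proof (intro conjI allI impI)
  show "Vector_Spaces.linear (*s) (*) (std_form u)" for u :: "'a ^ 6"
    by unfold_locales (simp_all add: std_form_def algebra_simps)
  show "Vector_Spaces.linear (*s) (*) (\<lambda>u. std_form u v)" for v :: "'a ^ 6"
    by unfold_locales (simp_all add: std_form_def algebra_simps)
  show "std_form u v = - std_form v u" for u v :: "'a ^ 6"
    by (simp add: std_form_def algebra_simps)
  show "u = 0" if "\<forall>v. std_form u v = 0" for u :: "'a ^ 6"
    using that std_form_nondegenerate by blast
qed

lemma invertible_of_std_form: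
  assumes "\<And>u v. b (g *v u) (g *v v) = m * std_form u v" "m \<noteq> 0" and "\<And>v. b 0 v = 0"
  shows "invertible (g :: 'a::field ^ 6 ^ 6)"
  unfolding invertible_left_inverse matrix_left_invertible_ker
proof (intro allI impI)
  fix u assume "g *v u = 0"
  then have "m * std_form u v = 0" for v using assms(1) [of u v] assms(3) by simp
  then show "u = 0" using assms(2) std_form_nondegenerate by (metis mult_eq_0_iff)
qed

lemma GSp_std_formI:
  assumes "\<And>u v. std_form (g *v u) (g *v v) = m * std_form u v" "m \<noteq> 0"
  shows "g \<in> GSp (std_form :: 'a::field ^ 6 \<Rightarrow> _)"
  unfolding GSp_def using invertible_of_std_form [OF assms] assms by (auto simp: std_form_def)

lemma GSp_mult:
  assumes "g \<in> GSp b" "h \<in> GSp b"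
  shows "g ** h \<in> GSp b"
proof -
  obtain m n where "m \<noteq> 0" "n \<noteq> 0" "\<And>u v. b (g *v u) (g *v v) = m * b u v"
    "\<And>u v. b (h *v u) (h *v v) = n * b u v"
    using assms unfolding GSp_def by blast
  then show ?thesis
    using assms invertible_mult unfolding GSp_def
    by (auto simp: matrix_vector_mul_assoc [symmetric] intro!: exI [of _ "m * n"])
qed

lemma GSp_inverse:
  assumes "g \<in> GSp b"
  shows "\<exists>h\<in>GSp b. g ** h = mat 1 \<and> h ** g = mat 1"
proof -
  obtain m where m: "m \<noteq> 0" "\<And>u v. b (g *v u) (g *v v) = m * b u v" and i: "invertible g"
    using assms unfolding GSp_def by blast
  then obtain h where h: "g ** h = mat 1" "h ** g = mat 1"
    unfolding invertible_def by blast
  have "b (h *v u) (h *v v) = inverse m * b u v" for u v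
    using m(1) m(2) [of "h *v u" "h *v v"] by (simp add: matrix_vector_mul_assoc h)
  moreover have "invertible h" using h unfolding invertible_def by blast
  ultimately have "h \<in> GSp b"
    using m(1) unfolding GSp_def by (auto intro!: exI [of _ "inverse m"])
  then show ?thesis using h by blast
qed

section \<open>The Siegel unipotent radicals and their action on rank-one vectors\<close>

definition upper :: "'a::field ^ 6 \<Rightarrow> 'a ^ 6 ^ 6" where
  "upper C = vec6 (vec6 1 0 0 (C$0) (C$3) (C$4)) (vec6 0 1 0 (C$3) (C$1) (C$5))
     (vec6 0 0 1 (C$4) (C$5) (C$2)) (axis 3 1) (axis 4 1) (axis 5 1)"

definition lower :: "'a::field ^ 6 \<Rightarrow> 'a ^ 6 ^ 6" where
  "lower C = vec6 (axis 0 1) (axis 1 1) (axis 2 1) (vec6 (C$0) (C$3) (C$4) 1 0 0)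
     (vec6 (C$3) (C$1) (C$5) 0 1 0) (vec6 (C$4) (C$5) (C$2) 0 0 1)"

lemma upper_GSp: "upper C \<in> GSp std_form"
  by (rule GSp_std_formI [of _ 1])
    (simp_all add: std_form_def upper_def matrix_vector_mult_def sum_6 axis_def algebra_simps)

lemma lower_GSp: "lower C \<in> GSp std_form"
  by (rule GSp_std_formI [of _ 1])
    (simp_all add: std_form_def lower_def matrix_vector_mult_def sum_6 axis_def algebra_simps)

text \<open>\<open>lower C\<close> adds to each e_j the combination of the f_i with coefficients
  C_ij, so the term a E contributes a C to A.\<close>

lemma ext3_lower:
  "ext3 (lower C) (tri a A B d) $ (0,1,2) = a"
  "ext3 (lower C) (tri a A B d) $ (1,2,3) = A$0 + a * C$0"
  "ext3 (lower C) (tri a A B d) $ (0,2,4) = - (A$1 + a * C$1)"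
  "ext3 (lower C) (tri a A B d) $ (0,1,5) = A$2 + a * C$2"
  "ext3 (lower C) (tri a A B d) $ (1,2,4) = A$3 + a * C$3"
  "ext3 (lower C) (tri a A B d) $ (1,2,5) = A$4 + a * C$4"
  "ext3 (lower C) (tri a A B d) $ (0,1,4) = A$5 + a * C$5"
  by (simp_all add: ext3_def lower_def sum_6 axis_def tri_coords algebra_simps)

lemma ext3_upper:
  "ext3 (upper C) (tri a A B d) $ (3,4,5) = d"
  "ext3 (upper C) (tri a A B d) $ (0,4,5) = B$0 + d * C$0"
  "ext3 (upper C) (tri a A B d) $ (1,3,5) = - (B$1 + d * C$1)"
  "ext3 (upper C) (tri a A B d) $ (2,3,4) = B$2 + d * C$2"
  "ext3 (upper C) (tri a A B d) $ (1,4,5) = B$3 + d * C$3"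
  "ext3 (upper C) (tri a A B d) $ (2,4,5) = B$4 + d * C$4"
  "ext3 (upper C) (tri a A B d) $ (1,3,4) = B$5 + d * C$5"
  by (simp_all add: ext3_def upper_def sum_6 axis_def tri_coords algebra_simps)

lemma ext3_upper_012:
  "ext3 (upper C) (tri a A B d) $ (0,1,2) = a + strace A C + strace B (sadj C) + d * sdet C"
  by (simp add: ext3_def upper_def sum_6 axis_def tri_coords strace_def sadj_nth sdet_def
      power2_eq_square algebra_simps)

lemma quartic_tri_scale: "quartic (c *s tri a A B d) = c ^ 4 * quartic (tri a A B d)"
proof -
  have "sadj (c *s A) = c\<^sup>2 *s sadj A" for A
    by (rule vec6_eqI) (simp_all add: sadj_nth algebra_simps power2_eq_square)
  then show ?thesis
    unfolding tri_scale quartic_tri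
    by (simp add: strace_scale sdet_scale algebra_simps power2_eq_square power3_eq_cube power4_eq_xxxx)
qed

lemma tri_E_eq: "tri s 0 0 0 = s *s wedge3 (axis 0 1) (axis 1 1) (axis 2 1)"
  by (simp add: tri_def)

lemma ext3_upper_E: "ext3 (upper C) (tri s 0 0 0) = tri s 0 0 0"
proof -
  have "upper C *v axis 0 1 = axis 0 1" "upper C *v axis 1 1 = axis 1 1"
    "upper C *v axis 2 1 = axis 2 1"
    by (rule vec6_eqI; simp add: upper_def matrix_vector_mult_def sum_6 axis_def)+
  then show ?thesis by (simp add: tri_E_eq ext3_scale ext3_wedge3)
qed

text \<open>By \<open>ext3_upper_012\<close> this is the leading coordinate after applying
  \<open>upper C\<close>. If it vanished for every C, so would its homogeneous parts in C: C = 0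
  gives the constant part, C -> -C isolates the quadratic one and C -> 2C the cubic one.\<close>

lemma exists_upper_leading_coefficient:
  fixes a d :: "'a::field"
  assumes char: "(2::'a) \<noteq> 0" "(3::'a) \<noteq> 0" and nz: "tri a A B d \<noteq> 0"
  shows "\<exists>C. a + strace A C + strace B (sadj C) + d * sdet C \<noteq> 0"
proof (rule ccontr)
  assume "\<not> ?thesis"
  then have z: "a + strace A C + strace B (sadj C) + d * sdet C = 0" for C by blast
  have a: "a = 0" using z [of 0] by simp
  have "B = 0"
  proof (rule strace_sadj_nondegenerate [OF char(1)])
    fix C
    have "2 * strace B (sadj C) = (a + strace A C + strace B (sadj C) + d * sdet C)
        + (a + strace A (- C) + strace B (sadj (- C)) + d * sdet (- C))"
      by (simp add: a sadj_minus sdet_minus strace_minus)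
    also have "\<dots> = 0" by (simp only: z add_0)
    finally have "2 * strace B (sadj C) = 0" by simp
    then show "strace B (sadj C) = 0" using char by simp
  qed
  then have z': "strace A C + d * sdet C = 0" for C using z [of C] by (simp add: a)
  \<comment> \<open>Doubling C multiplies the linear part by 2 and the cubic part by 8, and 8 - 2 =
    6.\<close>
  have "6 * (d * sdet C) = 0" for C
  proof -
    have "6 * (d * sdet C) = (strace A (2 *s C) + d * sdet (2 *s C)) - 2 * (strace A C + d * sdet C)"
      by (simp add: sdet_scale strace_scale algebra_simps)
    then show ?thesis by (simp only: z' mult_zero_right diff_self)
  qed
  from this [of "vec6 1 1 1 0 0 0"] have "6 * d = 0" by (simp add: sdet_def)
  then have d: "d = 0" using numeral_neq_0 [OF char] by simp
  have "A = 0"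
    by (rule strace_nondegenerate [OF char(1)]) (use z' in \<open>simp add: d\<close>)
  then show False using nz by (simp add: a \<open>B = 0\<close> d tri_zero)
qed

lemma similitude_comp:
  assumes char: "(2::'a::field) \<noteq> 0" "(3::'a) \<noteq> 0" and sim: "similitude \<phi> (k::'a)"
    and g: "g \<in> GSp std_form" and c: "c \<noteq> 0"
  shows "similitude (\<lambda>T. c *s ext3 g (\<phi> T)) (c ^ 4 * (det g)\<^sup>2 * k)"
proof -
  obtain m where m: "m \<noteq> 0" "\<And>u v. std_form (g *v u) (g *v v) = m * std_form u v"
    and i: "invertible g"
    using g unfolding GSp_def by blast
  note W = primitive_trivectors_std_form [OF char(1)]
  have ex: "\<exists>a A B d. ext3 g T = tri a A B d" if "T \<in> primitive_trivectors std_form" for T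
    using ext3_primitive_trivectors [OF char symplectic_std_form symplectic_std_form m(2) that]
    unfolding W by blast
  have q: "quartic (c *s ext3 g T) = c ^ 4 * (det g)\<^sup>2 * quartic T"
    if "T \<in> primitive_trivectors std_form" for T
    using ex [OF that] quartic_tri_scale quartic_ext3 [OF i, of T] by (metis mult.assoc)
  have "c *s ext3 g T \<in> primitive_trivectors std_form" if "T \<in> primitive_trivectors std_form" for T
    using ex [OF that] tri_scale [of c] unfolding W by auto metis
  moreover have "det g \<noteq> 0" using i invertible_det_nz by blast
  ultimately show ?thesis
    using sim c unfolding similitude_def linear_endo_on_def
    by (simp add: q ext3_add ext3_scale vec.scale_right_distrib mult.commute mult.left_commute)
qed

lemma similitude_ext3:
  assumes char: "(2::'a::field) \<noteq> 0" "(3::'a) \<noteq> 0" and g: "g \<in> GSp std_form"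
  shows "similitude (ext3 g) ((det g)\<^sup>2 :: 'a)"
proof -
  have "similitude (\<lambda>T. T) (1 :: 'a)" by (simp add: similitude_def linear_endo_on_def)
  from similitude_comp [OF char this g, of 1] show ?thesis by simp
qed

lemma rank_one_to_E:
  fixes a d :: "'a::field"
  assumes char: "(2::'a) \<noteq> 0" "(3::'a) \<noteq> 0"
    and r: "rank_one (tri a A B d)" and nz: "tri a A B d \<noteq> 0"
  shows "\<exists>g\<in>GSp std_form. \<exists>s. s \<noteq> 0 \<and> ext3 g (tri a A B d) = tri s 0 0 0"
proof -
  obtain C where C: "a + strace A C + strace B (sadj C) + d * sdet C \<noteq> 0"
    using exists_upper_leading_coefficient [OF char nz] by blast
  note u = similitude_ext3 [OF char upper_GSp [of C]]
  obtain s A1 B1 d1 where 1: "ext3 (upper C) (tri a A B d) = tri s A1 B1 d1"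
    using similitude_tri_ex [OF char u] by blast
  have s: "s \<noteq> 0" using C ext3_upper_012 [of C a A B d] by (simp add: 1 tri_nth)
  \<comment> \<open>This choice turns A1 into A1 + s ?D = 0 and leaves s unchanged.\<close>
  let ?D = "- (inverse s *s A1)"
  note l = similitude_ext3 [OF char lower_GSp [of ?D]]
  obtain s' A2 B2 d2 where 2: "ext3 (lower ?D) (tri s A1 B1 d1) = tri s' A2 B2 d2"
    using similitude_tri_ex [OF char l] by blast
  have s': "s' = s" using ext3_lower(1) [of ?D s A1 B1 d1] by (simp add: 2 tri_nth)
  have i: "s * (inverse s * x) = x" for x using s by simp
  have A2: "A2 = 0"
    using ext3_lower(2-) [of ?D s A1 B1 d1] by (intro vec6_eqI) (simp_all add: 2 tri_nth i)
  have "rank_one (tri s' A2 B2 d2)"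
    using similitude_rank_one [OF char u r] similitude_rank_one [OF char l, of s A1 B1 d1]
    unfolding 1 2 by blast
  then have "B2 = 0 \<and> d2 = 0" unfolding A2 by (rule rank_one_EB [OF char]) (simp add: s' s)
  then have "ext3 (lower ?D ** upper C) (tri a A B d) = tri s 0 0 0"
    by (simp add: ext3_mult [OF char tri_in_trivectors] 1 2 A2 s')
  then show ?thesis using s GSp_mult [OF lower_GSp upper_GSp] by blast
qed

text \<open>That d is nonzero says that the vector is not orthogonal to E under the Hessian. Only
  \<open>upper\<close> is used, because these maps fix E.\<close>

lemma rank_one_to_F:
  fixes a d :: "'a::field"
  assumes char: "(2::'a) \<noteq> 0" "(3::'a) \<noteq> 0"
    and r: "rank_one (tri a A B d)" and d: "d \<noteq> 0"
  shows "\<exists>C. ext3 (upper C) (tri a A B d) = tri 0 0 0 d"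
proof -
  let ?D = "- (inverse d *s B)"
  note u = similitude_ext3 [OF char upper_GSp [of ?D]]
  obtain a' A' B' d' where 1: "ext3 (upper ?D) (tri a A B d) = tri a' A' B' d'"
    using similitude_tri_ex [OF char u] by blast
  have d': "d' = d" using ext3_upper(1) [of ?D a A B d] by (simp add: 1 tri_nth)
  have i: "d * (inverse d * x) = x" for x using d by simp
  have B': "B' = 0"
    using ext3_upper(2-) [of ?D a A B d] by (intro vec6_eqI) (simp_all add: 1 tri_nth i)
  have "rank_one (tri a' A' B' d')"
    using similitude_rank_one [OF char u r] unfolding 1 .
  then have "A' = 0 \<and> a' = 0" unfolding B' by (rule rank_one_FA [OF char]) (simp add: d' d)
  then show ?thesis using 1 by (auto simp: B' d')
qed

definition is_GSp_map :: "('a::field ^ (6 \<times> 6 \<times> 6) \<Rightarrow> 'a ^ (6 \<times> 6 \<times> 6)) \<Rightarrow> bool" where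
  "is_GSp_map \<phi> \<longleftrightarrow> (\<exists>c g. c \<noteq> 0 \<and> g \<in> GSp std_form \<and>
     (\<forall>T\<in>primitive_trivectors std_form. \<phi> T = c *s ext3 g T))"

text \<open>This allows \<phi> to be replaced by its composite with a normalising map, as
  \<open>GSp\<close> contains inverses.\<close>

lemma is_GSp_map_cancel:
  assumes char: "(2::'a::field) \<noteq> 0" "(3::'a) \<noteq> 0" and sim: "similitude \<phi> (k::'a)"
    and g: "g \<in> GSp std_form" and c: "c \<noteq> 0" and m: "is_GSp_map (\<lambda>T. c *s ext3 g (\<phi> T))"
  shows "is_GSp_map \<phi>"
proof -
  obtain c' g' where c': "c' \<noteq> 0" and g': "g' \<in> GSp std_form"
    and e: "\<And>T. T \<in> primitive_trivectors std_form \<Longrightarrow> c *s ext3 g (\<phi> T) = c' *s ext3 g' T"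
    using m unfolding is_GSp_map_def by blast
  obtain h where h: "h \<in> GSp std_form" "h ** g = mat 1" using GSp_inverse [OF g] by blast
  have "\<phi> T = (inverse c * c') *s ext3 (h ** g') T" if T: "T \<in> primitive_trivectors std_form" for T
  proof -
    have t: "T \<in> trivectors" using T by (simp add: primitive_trivectors_def)
    have p: "\<phi> T \<in> trivectors"
      using sim T by (auto simp: similitude_def linear_endo_on_def primitive_trivectors_def)
    have "c *s \<phi> T = c *s ext3 h (ext3 g (\<phi> T))"
      using ext3_mult [OF char p, of h g] ext3_mat_1 [OF char p] h(2) by simp
    also have "\<dots> = c' *s ext3 h (ext3 g' T)"
      using e [OF T] by (metis ext3_scale)
    finally have "inverse c *s (c *s \<phi> T) = inverse c *s (c' *s ext3 (h ** g') T)"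
      by (simp only: ext3_mult [OF char t])
    then show ?thesis using c by simp
  qed
  moreover have "inverse c * c' \<noteq> 0" using c c' by simp
  ultimately show ?thesis unfolding is_GSp_map_def using GSp_mult [OF h(1) g'] by blast
qed

section \<open>Reduction to the determinant on symmetric matrices\<close>

text \<open>The Hessians at the two fixed lines recognise a and d, so \<phi> respects the middle
  part. There \<open>grad\<close> yields the two cubics, which separate the copies of Sym_3, and the
  Hessian at the sum of the two lines yields the trace pairing.\<close>

lemma similitude_normal_form:
  fixes \<alpha> \<beta> k :: "'a::field"
  assumes char: "(2::'a) \<noteq> 0" "(3::'a) \<noteq> 0" and sim: "similitude \<phi> k"
    and E: "\<phi> (tri 1 0 0 0) = tri \<alpha> 0 0 0" and F: "\<phi> (tri 0 0 0 1) = tri 0 0 0 \<beta>"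
  obtains \<rho> \<sigma> where "\<And>a A B d. \<phi> (tri a A B d) = tri (\<alpha> * a) (\<rho> A) (\<sigma> B) (\<beta> * d)"
    and "\<alpha> \<noteq> 0" and "\<beta> \<noteq> 0" and "(\<alpha> * \<beta>)\<^sup>2 = k" and "\<And>B. \<alpha> * sdet (\<sigma> B) = k * sdet B"
    and "\<And>A B. \<alpha> * \<beta> * strace (\<rho> A) (\<sigma> B) = k * strace A B"
proof -
  note n = numeral_neq_0 [OF char]
  note k = similitude_quartic(2) [OF char sim]
  note lin = similitude_linear [OF char sim]
  have sq: "(\<alpha> * \<beta>)\<^sup>2 = k"
    using similitude_hess [OF char sim, of 1 0 0 0 0 0 0 1] n by (simp add: E F hess_E)
  have nz: "\<alpha> \<noteq> 0" "\<beta> \<noteq> 0" using sq k by auto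
  have ad: "(\<alpha> * d')\<^sup>2 = k * d\<^sup>2 \<and> (\<beta> * a')\<^sup>2 = k * a\<^sup>2" if "\<phi> (tri a A B d) = tri a' A' B' d'"
    for a A B d a' A' B' d'
    using similitude_hess [OF char sim, of 1 0 0 0 a A B d]
      similitude_hess [OF char sim, of 0 0 0 1 a A B d] n
    by (simp add: E F hess_E hess_F that)
  have mid: "\<exists>A' B'. \<phi> (tri 0 A B 0) = tri 0 A' B' 0" for A B
  proof -
    obtain a' A' B' d' where 1: "\<phi> (tri 0 A B 0) = tri a' A' B' d'"
      using similitude_tri_ex [OF char sim] by blast
    have "a' = 0 \<and> d' = 0" using ad [OF 1] nz by simp
    then show ?thesis using 1 by blast
  qed
  \<comment> \<open>Surjectivity on the middle part supplies every translation C needed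
    below.\<close>
  have mid_surj: "\<exists>A B. \<phi> (tri 0 A B 0) = tri 0 A' B' 0" for A' B'
  proof -
    obtain a A B d where 1: "\<phi> (tri a A B d) = tri 0 A' B' 0"
      using similitude_surj [OF char sim] by blast
    have "a = 0 \<and> d = 0" using ad [OF 1] k by simp
    then show ?thesis using 1 by blast
  qed
  have cub: "\<alpha> * sdet B' = k * sdet B" "\<beta> * sdet A' = k * sdet A"
    if "\<phi> (tri 0 A B 0) = tri 0 A' B' 0" for A B A' B'
    using similitude_grad [OF char sim, of 0 A B 0 1 0 0 0]
      similitude_grad [OF char sim, of 0 A B 0 0 0 0 1] n
    by (simp_all add: E F grad_E grad_F that)
  have "\<exists>A'. \<phi> (tri 0 A 0 0) = tri 0 A' 0 0" for A
  proof -
    obtain A' B' where 1: "\<phi> (tri 0 A 0 0) = tri 0 A' B' 0" using mid by blast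
    \<comment> \<open>By \<open>cub\<close> the determinant of the second component of an image does
      not depend on the first argument, so B' is a period of the cubic.\<close>
    have "B' = 0"
    proof (rule sdet_translation_invariant [OF char(1)])
      fix C
      obtain A2 B2 where 2: "\<phi> (tri 0 A2 B2 0) = tri 0 0 C 0" using mid_surj by blast
      have 3: "\<phi> (tri 0 (A + A2) B2 0) = tri 0 A' (B' + C) 0"
        using lin(1) [of 0 A 0 0 0 A2 B2 0] by (simp add: tri_add 1 2)
      show "sdet (B' + C) = sdet C" using cub(1) [OF 3] cub(1) [OF 2] nz by (metis mult_left_cancel)
    qed
    then show ?thesis using 1 by blast
  qed
  then obtain \<rho> where \<rho>: "\<And>A. \<phi> (tri 0 A 0 0) = tri 0 (\<rho> A) 0 0" by metis
  have "\<exists>B'. \<phi> (tri 0 0 B 0) = tri 0 0 B' 0" for B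
  proof -
    obtain A' B' where 1: "\<phi> (tri 0 0 B 0) = tri 0 A' B' 0" using mid by blast
    have "A' = 0"
    proof (rule sdet_translation_invariant [OF char(1)])
      fix C
      obtain A2 B2 where 2: "\<phi> (tri 0 A2 B2 0) = tri 0 C 0 0" using mid_surj by blast
      have 3: "\<phi> (tri 0 A2 (B + B2) 0) = tri 0 (A' + C) B' 0"
        using lin(1) [of 0 0 B 0 0 A2 B2 0] by (simp add: tri_add 1 2)
      show "sdet (A' + C) = sdet C" using cub(2) [OF 3] cub(2) [OF 2] nz by (metis mult_left_cancel)
    qed
    then show ?thesis using 1 by blast
  qed
  then obtain \<sigma> where \<sigma>: "\<And>B. \<phi> (tri 0 0 B 0) = tri 0 0 (\<sigma> B) 0" by metis
  have \<phi>: "\<phi> (tri a A B d) = tri (\<alpha> * a) (\<rho> A) (\<sigma> B) (\<beta> * d)" for a A B d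
  proof -
    have "\<phi> (tri a 0 0 0) = tri (\<alpha> * a) 0 0 0"
      using lin(2) [of a 1 0 0 0] by (simp add: tri_scale E mult.commute)
    moreover have "\<phi> (tri 0 0 0 d) = tri 0 0 0 (\<beta> * d)"
      using lin(2) [of d 0 0 0 1] by (simp add: tri_scale F mult.commute)
    ultimately show ?thesis
      using lin(1) [of a 0 0 0 0 A B d] lin(1) [of 0 A 0 0 0 0 B d] lin(1) [of 0 0 B 0 0 0 0 d]
      by (simp add: tri_add \<rho> \<sigma>)
  qed
  have tr: "\<alpha> * \<beta> * strace (\<rho> A) (\<sigma> B) = k * strace A B" for A B
  proof -
    have "\<phi> (tri 1 0 0 1) = tri \<alpha> 0 0 \<beta>"
      using lin(1) [of 1 0 0 0 0 0 0 1] by (simp add: tri_add E F)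
    moreover have "\<phi> (tri 0 A B 0) = tri 0 (\<rho> A) (\<sigma> B) 0" by (simp add: \<phi>)
    ultimately have "3456 * (\<alpha> * \<beta> * strace (\<rho> A) (\<sigma> B)) = 3456 * (k * strace A B)"
      using similitude_hess [OF char sim, of 1 0 0 1 0 A B 0] by (simp add: hess_EF algebra_simps)
    then show ?thesis using n by simp
  qed
  show thesis
    by (rule that [OF \<phi> nz sq _ tr]) (rule cub(1) [OF \<sigma>])
qed

section \<open>Symmetric matrices of rank one and the Levi subgroup\<close>

definition sq :: "'a::field ^ 3 \<Rightarrow> 'a ^ 6" where
  "sq v = vec6 ((v$1)\<^sup>2) ((v$2)\<^sup>2) ((v$3)\<^sup>2) (v$1 * v$2) (v$1 * v$3) (v$2 * v$3)"

text \<open>\<open>sq v\<close> is v v^T, and \<open>spr u v\<close> is its polarisation u v^T + v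
  u^T.\<close>

definition spr :: "'a::field ^ 3 \<Rightarrow> 'a ^ 3 \<Rightarrow> 'a ^ 6" where
  "spr u v = vec6 (2 * u$1 * v$1) (2 * u$2 * v$2) (2 * u$3 * v$3) (u$1 * v$2 + u$2 * v$1)
     (u$1 * v$3 + u$3 * v$1) (u$2 * v$3 + u$3 * v$2)"

definition det3 :: "'a::field ^ 3 \<Rightarrow> 'a ^ 3 \<Rightarrow> 'a ^ 3 \<Rightarrow> 'a" where
  "det3 x y z = x$1 * (y$2 * z$3 - y$3 * z$2) + x$2 * (y$3 * z$1 - y$1 * z$3)
     + x$3 * (y$1 * z$2 - y$2 * z$1)"

text \<open>The block matrix \<open>diag(P, cof P)\<close>, where \<open>P\<close> has the columns \<open>x\<close>, \<open>y\<close>, \<open>z\<close>.\<close>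

definition levi :: "'a::field ^ 3 \<Rightarrow> 'a ^ 3 \<Rightarrow> 'a ^ 3 \<Rightarrow> 'a ^ 6 ^ 6" where
  "levi x y z = vec6
     (vec6 (x$1) (y$1) (z$1) 0 0 0) (vec6 (x$2) (y$2) (z$2) 0 0 0) (vec6 (x$3) (y$3) (z$3) 0 0 0)
     (vec6 0 0 0 (y$2 * z$3 - y$3 * z$2) (z$2 * x$3 - z$3 * x$2) (x$2 * y$3 - x$3 * y$2))
     (vec6 0 0 0 (y$3 * z$1 - y$1 * z$3) (z$3 * x$1 - z$1 * x$3) (x$3 * y$1 - x$1 * y$3))
     (vec6 0 0 0 (y$1 * z$2 - y$2 * z$1) (z$1 * x$2 - z$2 * x$1) (x$1 * y$2 - x$2 * y$1))"

lemma levi_GSp: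
  assumes "det3 x y z \<noteq> 0"
  shows "levi x y z \<in> GSp std_form"
  by (rule GSp_std_formI [OF _ assms])
    (simp add: std_form_def levi_def det3_def matrix_vector_mult_def sum_6 algebra_simps)

text \<open>The matrix is P diag(p, q, r) P^T, where P has the columns x, y, z.\<close>

lemma sdet_sq_combination:
  "sdet (p *s sq x + q *s sq y + r *s sq z) = p * q * r * (det3 x y z)\<^sup>2"
  by (simp add: sdet_def sq_def det3_def algebra_simps power2_eq_square)

text \<open>All 2 x 2 minors vanish. A nonzero diagonal entry serves as c, which avoids square
  roots; if the diagonal is zero, the minors force the other entries to vanish.\<close>

lemma sadj_eq_0:
  fixes A :: "'a::field ^ 6"
  assumes "sadj A = 0" "A \<noteq> 0"
  shows "\<exists>c v. c \<noteq> 0 \<and> A = c *s sq v"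
proof -
  have s: "A$1 * A$2 = (A$5)\<^sup>2" "A$0 * A$2 = (A$4)\<^sup>2" "A$0 * A$1 = (A$3)\<^sup>2"
     "A$4 * A$5 = A$2 * A$3" "A$3 * A$5 = A$1 * A$4" "A$3 * A$4 = A$0 * A$5"
    using assms(1) sadj_nth [of A] by simp_all
  consider "A$0 \<noteq> 0" | "A$1 \<noteq> 0" | "A$2 \<noteq> 0" | "A$0 = 0" "A$1 = 0" "A$2 = 0" by blast
  then show ?thesis
  proof cases
    case 1
    have "A = A$0 *s sq (vector [1, A$3 / A$0, A$4 / A$0])"
      using 1 s by (intro vec6_eqI) (simp_all add: sq_def field_simps power2_eq_square)
    then show ?thesis using 1 by blast
  next
    case 2
    have "A = A$1 *s sq (vector [A$3 / A$1, 1, A$5 / A$1])"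
      using 2 s by (intro vec6_eqI) (simp_all add: sq_def field_simps power2_eq_square)
    then show ?thesis using 2 by blast
  next
    case 3
    have "A = A$2 *s sq (vector [A$4 / A$2, A$5 / A$2, 1])"
      using 3 s by (intro vec6_eqI) (simp_all add: sq_def field_simps power2_eq_square)
    then show ?thesis using 3 by blast
  next
    case 4
    then have "A = 0" using s by (intro vec6_eqI) simp_all
    then show ?thesis using assms(2) by simp
  qed
qed

lemma ext3_levi_E:
  assumes char: "(2::'a::field) \<noteq> 0" "(3::'a) \<noteq> 0"
  shows "ext3 (levi x y z) (tri (s :: 'a) 0 0 0) = tri (det3 x y z * s) 0 0 0"
  by (rule trivector_eqI [OF ext3_in_trivectors [OF char tri_in_trivectors] tri_in_trivectors])
    (simp_all add: ext3_def levi_def sum_6 tri_coords det3_def algebra_simps)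

lemma ext3_levi_F:
  assumes char: "(2::'a::field) \<noteq> 0" "(3::'a) \<noteq> 0"
  shows "ext3 (levi x y z) (tri 0 0 0 (s :: 'a)) = tri 0 0 0 ((det3 x y z)\<^sup>2 * s)"
  by (rule trivector_eqI [OF ext3_in_trivectors [OF char tri_in_trivectors] tri_in_trivectors])
    (simp_all add: ext3_def levi_def sum_6 tri_coords det3_def algebra_simps power2_eq_square)

text \<open>In matrix terms B goes to det(P) P B P^T; the factor arises because the cofactor matrix
  of cof P is det(P) P.\<close>

lemma ext3_levi_B:
  assumes char: "(2::'a::field) \<noteq> 0" "(3::'a) \<noteq> 0"
  shows "ext3 (levi x y z) (tri 0 0 (B :: 'a ^ 6) 0) = tri 0 0 (det3 x y z *s (B$0 *s sq x + B$1 *s sq y + B$2 *s sq z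
    + B$3 *s spr x y + B$4 *s spr x z + B$5 *s spr y z)) 0"
  by (rule trivector_eqI [OF ext3_in_trivectors [OF char tri_in_trivectors] tri_in_trivectors])
    (simp_all add: ext3_def levi_def sum_6 tri_coords det3_def sq_def spr_def algebra_simps power2_eq_square)

definition torus :: "'a::field \<Rightarrow> 'a ^ 6 ^ 6" where
  "torus t = vec6 (vec6 1 0 0 0 0 0) (vec6 0 1 0 0 0 0) (vec6 0 0 1 0 0 0)
     (vec6 0 0 0 t 0 0) (vec6 0 0 0 0 t 0) (vec6 0 0 0 0 0 t)"

lemma torus_GSp: "t \<noteq> 0 \<Longrightarrow> torus t \<in> GSp std_form"
  by (rule GSp_std_formI [of _ t])
    (simp_all add: std_form_def torus_def matrix_vector_mult_def sum_6 algebra_simps)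

lemma ext3_torus:
  assumes char: "(2::'a::field) \<noteq> 0" "(3::'a) \<noteq> 0"
  shows "ext3 (torus t) (tri (a :: 'a) A B d) = tri a (t *s A) (t\<^sup>2 *s B) (t ^ 3 * d)"
  by (rule trivector_eqI [OF ext3_in_trivectors [OF char tri_in_trivectors] tri_in_trivectors])
    (simp_all add: ext3_def torus_def sum_6 tri_coords power2_eq_square power3_eq_cube)

text \<open>The cubic gives k = \<alpha>, hence \<open>\<alpha> * \<beta>\<^sup>2 = 1\<close>, and
  the pairing makes \<rho> multiplication by \<alpha> \<beta>. The four factors \<alpha>, \<alpha>
  \<beta>, 1, \<beta> are \<alpha> times the weights 1, t, t^2, t^3 of \<open>torus t\<close> at t =
  \<beta>.\<close>

lemma is_GSp_map_rigid:
  fixes \<alpha> \<beta> k :: "'a::field"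
  assumes char: "(2::'a) \<noteq> 0" "(3::'a) \<noteq> 0" and sim: "similitude \<phi> k"
    and E: "\<phi> (tri 1 0 0 0) = tri \<alpha> 0 0 0" and F: "\<phi> (tri 0 0 0 1) = tri 0 0 0 \<beta>"
    and B: "\<And>B. \<phi> (tri 0 0 B 0) = tri 0 0 B 0"
  shows "is_GSp_map \<phi>"
proof -
  obtain \<rho> \<sigma> where \<phi>: "\<And>a A B d. \<phi> (tri a A B d) = tri (\<alpha> * a) (\<rho> A) (\<sigma> B) (\<beta> * d)"
    and nz: "\<alpha> \<noteq> 0" "\<beta> \<noteq> 0" and sqk: "(\<alpha> * \<beta>)\<^sup>2 = k"
    and cub: "\<And>B. \<alpha> * sdet (\<sigma> B) = k * sdet B"
    and tr: "\<And>A B. \<alpha> * \<beta> * strace (\<rho> A) (\<sigma> B) = k * strace A B"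
    using similitude_normal_form [OF char sim E F] by blast
  have \<sigma>: "\<sigma> B = B" for B using B [of B] by (simp add: \<phi> tri_eq_iff)
  have k: "k = \<alpha>" using cub [of "vec6 1 1 1 0 0 0"] by (simp add: \<sigma> sdet_def)
  have ab: "\<alpha> * \<beta>\<^sup>2 = 1" using sqk nz by (simp add: k power2_eq_square ac_simps)
  have \<rho>: "\<rho> A = \<alpha> *s (\<beta> *s A)" for A
  proof -
    have "\<beta> *s \<rho> A - A = 0"
    proof (rule strace_nondegenerate [OF char(1)])
      fix B
      have "\<alpha> * (\<beta> * strace (\<rho> A) B) = \<alpha> * strace A B" using tr [of A B] by (simp add: \<sigma> k mult.assoc)
      then have e: "\<beta> * strace (\<rho> A) B = strace A B" using nz by simp
      have "strace (\<beta> *s \<rho> A - A) B = \<beta> * strace (\<rho> A) B - strace A B"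
        by (simp add: strace_def algebra_simps)
      then show "strace (\<beta> *s \<rho> A - A) B = 0" by (simp add: e)
    qed
    then have "A = \<beta> *s \<rho> A" by simp
    then have "\<alpha> *s (\<beta> *s A) = \<alpha> *s (\<beta> *s (\<beta> *s \<rho> A))" by simp
    then show ?thesis using ab by (simp add: power2_eq_square mult.assoc)
  qed
  have "\<phi> T = \<alpha> *s ext3 (torus \<beta>) T" if T: "T \<in> primitive_trivectors std_form" for T
  proof -
    obtain a A B d where T: "T = tri a A B d"
      using T unfolding primitive_trivectors_std_form [OF char(1)] by blast
    have "\<alpha> * \<beta> ^ 3 = \<beta>" using ab by (simp add: power3_eq_cube power2_eq_square)
    then show ?thesis
      unfolding T \<phi> ext3_torus [OF char] tri_scale \<rho> \<sigma>
      using ab by (simp add: mult.assoc [symmetric])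
  qed
  then show ?thesis
    unfolding is_GSp_map_def using nz torus_GSp by blast
qed

section \<open>Linear maps scaling the determinant of symmetric matrices\<close>

lemma similitude_adjugate:
  fixes \<sigma> :: "'a::field ^ 6 \<Rightarrow> 'a ^ 6"
  assumes char: "(2::'a) \<noteq> 0" and add: "\<And>A B. \<sigma> (A + B) = \<sigma> A + \<sigma> B"
    and diff: "\<And>A B. \<sigma> (A - B) = \<sigma> A - \<sigma> B"
    and cub: "\<And>A. \<alpha> * sdet (\<sigma> A) = k * sdet A"
  shows "\<alpha> * strace (\<sigma> A) (sadj (\<sigma> B)) = k * strace A (sadj B)"
proof -
  have "\<alpha> * (sdet (\<sigma> A + \<sigma> B) + sdet (\<sigma> A - \<sigma> B)) = k * (sdet (A + B) + sdet (A - B))"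
    by (simp only: add [symmetric] diff [symmetric] distrib_left cub)
  then have "2 * (\<alpha> * strace (\<sigma> A) (sadj (\<sigma> B))) + 2 * (\<alpha> * sdet (\<sigma> A)) =
      2 * (k * strace A (sadj B)) + 2 * (k * sdet A)"
    unfolding sdet_add_sdet_diff by (simp add: algebra_simps)
  then show ?thesis unfolding cub using char by simp
qed

lemma axis_component: "axis k c $ i = (if i = k then c else 0)"
  by (simp add: axis_def)

text \<open>Once \<sigma> is known on the diagonal units, the polarised cubic \<open>adj\<close>
  determines its other entries up to signs, and a determinant relates the signs.\<close>

lemma is_GSp_map_diagonal:
  fixes \<alpha> \<beta> k :: "'a::field"
  assumes char: "(2::'a) \<noteq> 0" "(3::'a) \<noteq> 0" and sim: "similitude \<phi> k"
    and E: "\<phi> (tri 1 0 0 0) = tri \<alpha> 0 0 0" and F: "\<phi> (tri 0 0 0 1) = tri 0 0 0 \<beta>"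
    and D: "\<phi> (tri 0 0 (axis 0 1) 0) = tri 0 0 (axis 0 l0) 0"
      "\<phi> (tri 0 0 (axis 1 1) 0) = tri 0 0 (axis 1 l1) 0"
      "\<phi> (tri 0 0 (axis 2 1) 0) = tri 0 0 (axis 2 l2) 0"
  shows "is_GSp_map \<phi>"
proof -
  obtain \<rho> \<sigma> where \<phi>: "\<And>a A B d. \<phi> (tri a A B d) = tri (\<alpha> * a) (\<rho> A) (\<sigma> B) (\<beta> * d)"
    and nz: "\<alpha> \<noteq> 0" "\<beta> \<noteq> 0" and "(\<alpha> * \<beta>)\<^sup>2 = k"
    and cub: "\<And>B. \<alpha> * sdet (\<sigma> B) = k * sdet B"
    and "\<And>A B. \<alpha> * \<beta> * strace (\<rho> A) (\<sigma> B) = k * strace A B"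
    using similitude_normal_form [OF char sim E F] by blast
  note k = similitude_quartic(2) [OF char sim]
  have add: "\<sigma> (A + B) = \<sigma> A + \<sigma> B" and diff: "\<sigma> (A - B) = \<sigma> A - \<sigma> B"
    and scale: "\<sigma> (c *s A) = c *s \<sigma> A" for A B c
    using similitude_linear(1) [OF char sim, of 0 0 A 0] similitude_linear(2) [OF char sim, of c 0 0 A 0]
      similitude_diff [OF char sim, of 0 0 A 0 0 0 B 0]
    by (simp_all add: tri_add tri_diff tri_scale \<phi> tri_eq_iff)
  note adj = similitude_adjugate [OF char(1) add diff cub]
  have l: "\<sigma> (axis 0 1) = axis 0 l0" "\<sigma> (axis 1 1) = axis 1 l1" "\<sigma> (axis 2 1) = axis 2 l2"
    using D by (simp_all add: \<phi> tri_eq_iff)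
  have lk: "\<alpha> * (l0 * l1 * l2) = k"
    using cub [of "axis 0 1 + axis 1 1 + axis 2 1"] by (simp add: add l sdet_def axis_component)
  then have l_nz: "l0 \<noteq> 0" "l1 \<noteq> 0" "l2 \<noteq> 0" using k by auto
  \<comment> \<open>The adjugate of the sum of two diagonal units is the third one, so
    \<open>adj\<close> reads off one diagonal entry of \<sigma> A.\<close>
  have diag: "\<sigma> A $ 0 = 0" "\<sigma> A $ 1 = 0" "\<sigma> A $ 2 = 0" if "A $ 0 = 0" "A $ 1 = 0" "A $ 2 = 0" for A
    using adj [of A "axis 1 1 + axis 2 1"] adj [of A "axis 0 1 + axis 2 1"]
      adj [of A "axis 0 1 + axis 1 1"] that nz l_nz
    by (simp_all add: add l strace_def sadj_nth axis_component)
  \<comment> \<open>Pairing the adjugate of the image with the three diagonal units gives the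
    squares of its off-diagonal entries, only one of which is nonzero.\<close>
  have off3: "\<sigma> (axis 3 1) = axis 3 (\<sigma> (axis 3 1) $ 3) \<and> \<alpha> * l2 * (\<sigma> (axis 3 1) $ 3)\<^sup>2 = k"
  proof -
    note d = diag [of "axis 3 1"]
    have "\<alpha> * l2 * (\<sigma> (axis 3 1) $ 3)\<^sup>2 = k"
      using adj [of "axis 2 1" "axis 3 1"] d by (simp add: l strace_def sadj_nth axis_component mult.assoc)
    moreover have "\<sigma> (axis 3 1) $ 4 = 0" "\<sigma> (axis 3 1) $ 5 = 0"
      using adj [of "axis 1 1" "axis 3 1"] adj [of "axis 0 1" "axis 3 1"] d nz l_nz
      by (simp_all add: l strace_def sadj_nth axis_component)
    ultimately show ?thesis using d by (auto intro!: vec6_eqI simp: axis_component)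
  qed
  have off4: "\<sigma> (axis 4 1) = axis 4 (\<sigma> (axis 4 1) $ 4) \<and> \<alpha> * l1 * (\<sigma> (axis 4 1) $ 4)\<^sup>2 = k"
  proof -
    note d = diag [of "axis 4 1"]
    have "\<alpha> * l1 * (\<sigma> (axis 4 1) $ 4)\<^sup>2 = k"
      using adj [of "axis 1 1" "axis 4 1"] d by (simp add: l strace_def sadj_nth axis_component mult.assoc)
    moreover have "\<sigma> (axis 4 1) $ 3 = 0" "\<sigma> (axis 4 1) $ 5 = 0"
      using adj [of "axis 2 1" "axis 4 1"] adj [of "axis 0 1" "axis 4 1"] d nz l_nz
      by (simp_all add: l strace_def sadj_nth axis_component)
    ultimately show ?thesis using d by (auto intro!: vec6_eqI simp: axis_component)
  qed
  have off5: "\<sigma> (axis 5 1) = axis 5 (\<sigma> (axis 5 1) $ 5) \<and> \<alpha> * l0 * (\<sigma> (axis 5 1) $ 5)\<^sup>2 = k"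
  proof -
    note d = diag [of "axis 5 1"]
    have "\<alpha> * l0 * (\<sigma> (axis 5 1) $ 5)\<^sup>2 = k"
      using adj [of "axis 0 1" "axis 5 1"] d by (simp add: l strace_def sadj_nth axis_component mult.assoc)
    moreover have "\<sigma> (axis 5 1) $ 3 = 0" "\<sigma> (axis 5 1) $ 4 = 0"
      using adj [of "axis 2 1" "axis 5 1"] adj [of "axis 1 1" "axis 5 1"] d nz l_nz
      by (simp_all add: l strace_def sadj_nth axis_component)
    ultimately show ?thesis using d by (auto intro!: vec6_eqI simp: axis_component)
  qed
  define s3 s4 s5 where "s3 = \<sigma> (axis 3 1) $ 3" and "s4 = \<sigma> (axis 4 1) $ 4" and "s5 = \<sigma> (axis 5 1) $ 5"
  have s: "\<sigma> (axis 3 1) = axis 3 s3" "\<sigma> (axis 4 1) = axis 4 s4" "\<sigma> (axis 5 1) = axis 5 s5"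
    and sk: "\<alpha> * l2 * s3\<^sup>2 = k" "\<alpha> * l1 * s4\<^sup>2 = k" "\<alpha> * l0 * s5\<^sup>2 = k"
    using off3 off4 off5 unfolding s3_def s4_def s5_def by blast+
  have s_nz: "s3 \<noteq> 0" "s4 \<noteq> 0" "s5 \<noteq> 0" using sk k by auto
  \<comment> \<open>The squares in \<open>sk\<close> leave signs open. The matrix with zero diagonal
    and unit off-diagonal entries has determinant 2 and fixes the product of the three.\<close>
  have "\<alpha> * (2 * (s3 * s4 * s5)) = k * 2"
    using cub [of "axis 3 1 + axis 4 1 + axis 5 1"] by (simp add: add s sdet_def axis_component mult.assoc)
  then have "2 * (\<alpha> * (s3 * s4 * s5)) = 2 * k" by (simp add: algebra_simps)
  then have sss: "\<alpha> * (s3 * s4 * s5) = k" using char(1) by (metis mult_left_cancel)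
  have "\<alpha> * (s3 * s4 * s5) = \<alpha> * (l0 * s5\<^sup>2)" "\<alpha> * (l2 * s3\<^sup>2) = \<alpha> * (l0 * l1 * l2)"
    "\<alpha> * (l1 * s4\<^sup>2) = \<alpha> * (l0 * l1 * l2)"
    using sss sk lk by (simp_all add: mult.assoc)
  then have s34: "s3 * s4 = l0 * s5" and s33: "s3\<^sup>2 = l0 * l1" and s44: "s4\<^sup>2 = l0 * l2"
    using nz l_nz s_nz by (simp_all add: power2_eq_square algebra_simps)
  have \<sigma>: "\<sigma> B = vec6 (l0 * B$0) (l1 * B$1) (l2 * B$2) (s3 * B$3) (s4 * B$4) (s5 * B$5)" for B
  proof -
    have "B = B$0 *s axis 0 1 + B$1 *s axis 1 1 + B$2 *s axis 2 1 + B$3 *s axis 3 1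
        + B$4 *s axis 4 1 + B$5 *s axis 5 1"
      by (rule vec6_eqI) (simp_all add: axis_component)
    then have "\<sigma> B = \<sigma> (B$0 *s axis 0 1 + B$1 *s axis 1 1 + B$2 *s axis 2 1 + B$3 *s axis 3 1
        + B$4 *s axis 4 1 + B$5 *s axis 5 1)"
      by simp
    then show ?thesis unfolding add scale l s
      by (intro vec6_eqI) (simp_all add: axis_component)
  qed
  txt \<open>The relations among the \<open>l\<^sub>i\<close> and \<open>s\<^sub>i\<close> say that \<open>\<sigma> B = l0 P B P\<^sup>T\<close> with \<open>P = diag(1, s3/l0, s4/l0)\<close>.\<close>
  let ?x = "vector [1, 0, 0] :: 'a ^ 3" and ?y = "vector [0, s3 / l0, 0] :: 'a ^ 3"
    and ?z = "vector [0, 0, s4 / l0] :: 'a ^ 3"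
  let ?g = "levi ?x ?y ?z" and ?\<delta> = "det3 ?x ?y ?z"
  have \<delta>: "?\<delta> \<noteq> 0" using s_nz l_nz by (simp add: det3_def)
  obtain h where h: "h \<in> GSp std_form" "h ** ?g = mat 1"
    using GSp_inverse [OF levi_GSp [OF \<delta>]] by blast
  have hg: "ext3 h (ext3 ?g (tri a A B d)) = tri a A B d" for a A B d
    using ext3_mult [OF char tri_in_trivectors, of h ?g] ext3_mat_1 [OF char tri_in_trivectors]
    by (simp add: h)
  \<comment> \<open>\<open>ext3 ?g\<close> sends B to \<delta> P B P^T, which is \<delta> / l0 times
    \<sigma> B; \<open>?c\<close> compensates for this.\<close>
  let ?c = "?\<delta> / l0"
  have c: "?c \<noteq> 0" using \<delta> l_nz by simp
  have gB: "ext3 ?g (tri 0 0 B 0) = ?c *s tri 0 0 (\<sigma> B) 0" for B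
  proof -
    have "B$0 *s sq ?x + B$1 *s sq ?y + B$2 *s sq ?z + B$3 *s spr ?x ?y + B$4 *s spr ?x ?z
        + B$5 *s spr ?y ?z = inverse l0 *s \<sigma> B"
      unfolding \<sigma> using l_nz s33 s44 s34
      by (intro vec6_eqI) (simp_all add: sq_def spr_def field_simps power2_eq_square)
    then show ?thesis
      unfolding ext3_levi_B [OF char] by (simp add: tri_scale divide_inverse)
  qed
  let ?\<psi> = "\<lambda>T. ?c *s ext3 h (\<phi> T)"
  have "ext3 h (tri (?\<delta> * a) 0 0 0) = tri a 0 0 0" "ext3 h (tri 0 0 0 (?\<delta>\<^sup>2 * a)) = tri 0 0 0 a" for a
    using hg [of a 0 0 0] hg [of 0 0 0 a] by (simp_all add: ext3_levi_E [OF char] ext3_levi_F [OF char])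
  from this(1) [of "\<alpha> / ?\<delta>"] this(2) [of "\<beta> / ?\<delta>\<^sup>2"]
  have hE: "ext3 h (tri \<alpha> 0 0 0) = tri (\<alpha> / ?\<delta>) 0 0 0"
    and hF: "ext3 h (tri 0 0 0 \<beta>) = tri 0 0 0 (\<beta> / ?\<delta>\<^sup>2)"
    using \<delta> by simp_all
  have "is_GSp_map ?\<psi>"
  proof (rule is_GSp_map_rigid [OF char similitude_comp [OF char sim h(1) c]])
    show "?\<psi> (tri 1 0 0 0) = tri (?c * (\<alpha> / ?\<delta>)) 0 0 0"
      by (simp add: E hE tri_scale)
    show "?\<psi> (tri 0 0 0 1) = tri 0 0 0 (?c * (\<beta> / ?\<delta>\<^sup>2))"
      by (simp add: F hF tri_scale)
    show "?\<psi> (tri 0 0 B 0) = tri 0 0 B 0" for B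
    proof -
      have "?\<psi> (tri 0 0 B 0) = ext3 h (?c *s tri 0 0 (\<sigma> B) 0)"
        using similitude_zero [OF char sim] \<phi> [of 0 0 B 0] \<phi> [of 0 0 0 0]
        by (simp add: ext3_scale tri_zero [symmetric] tri_eq_iff)
      then show ?thesis by (simp add: gB [symmetric] hg)
    qed
  qed
  then show ?thesis by (rule is_GSp_map_cancel [OF char sim h(1) c])
qed

text \<open>By \<open>similitude_adjugate\<close> and surjectivity, \<sigma> preserves the vanishing
  of the adjugate. The diagonal units thus go to multiples of squares, whose vectors become the
  columns of P.\<close>

lemma is_GSp_map_of_lines:
  fixes \<alpha> \<beta> k :: "'a::field"
  assumes char: "(2::'a) \<noteq> 0" "(3::'a) \<noteq> 0" and sim: "similitude \<phi> k"
    and E: "\<phi> (tri 1 0 0 0) = tri \<alpha> 0 0 0" and F: "\<phi> (tri 0 0 0 1) = tri 0 0 0 \<beta>"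
  shows "is_GSp_map \<phi>"
proof -
  obtain \<rho> \<sigma> where \<phi>: "\<And>a A B d. \<phi> (tri a A B d) = tri (\<alpha> * a) (\<rho> A) (\<sigma> B) (\<beta> * d)"
    and nz: "\<alpha> \<noteq> 0" "\<beta> \<noteq> 0" and "(\<alpha> * \<beta>)\<^sup>2 = k"
    and cub: "\<And>B. \<alpha> * sdet (\<sigma> B) = k * sdet B"
    and "\<And>A B. \<alpha> * \<beta> * strace (\<rho> A) (\<sigma> B) = k * strace A B"
    using similitude_normal_form [OF char sim E F] by blast
  note k = similitude_quartic(2) [OF char sim]
  have add: "\<sigma> (A + B) = \<sigma> A + \<sigma> B" and diff: "\<sigma> (A - B) = \<sigma> A - \<sigma> B" for A B
    using similitude_linear(1) [OF char sim, of 0 0 A 0] similitude_diff [OF char sim, of 0 0 A 0 0 0 B 0]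
    by (simp_all add: tri_add tri_diff \<phi> tri_eq_iff)
  note adj = similitude_adjugate [OF char(1) add diff cub]
  have B: "\<phi> (tri 0 0 B 0) = tri 0 0 (\<sigma> B) 0" for B
    using similitude_zero [OF char sim] \<phi> [of 0 0 0 0] by (simp add: \<phi> tri_zero [symmetric] tri_eq_iff)
  have surj: "\<exists>A. \<sigma> A = C" for C
    using similitude_surj [OF char sim, of 0 0 C 0] by (auto simp: \<phi> tri_eq_iff)
  have sing: "\<exists>c v. c \<noteq> 0 \<and> \<sigma> A = c *s sq v" if "sadj A = 0" "\<sigma> A \<noteq> 0" for A
  proof (rule sadj_eq_0 [OF _ that(2)])
    show "sadj (\<sigma> A) = 0"
    proof (rule strace_nondegenerate [OF char(1)])
      fix C
      obtain C' where "\<sigma> C' = C" using surj by blast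
      then show "strace (sadj (\<sigma> A)) C = 0"
        using adj [of C' A] that(1) nz by (simp add: strace_commute)
    qed
  qed
  have I: "\<alpha> * sdet (\<sigma> (axis 0 1) + \<sigma> (axis 1 1) + \<sigma> (axis 2 1)) = k"
    using cub [of "axis 0 1 + axis 1 1 + axis 2 1"] by (simp add: add sdet_def axis_component)
  \<comment> \<open>If one of the three images vanished, the determinant in \<open>I\<close> would
    reduce to one of these, against k being nonzero.\<close>
  have a: "\<alpha> * sdet (\<sigma> (axis 1 1) + \<sigma> (axis 2 1)) = 0" "\<alpha> * sdet (\<sigma> (axis 0 1) + \<sigma> (axis 2 1)) = 0"
    "\<alpha> * sdet (\<sigma> (axis 0 1) + \<sigma> (axis 1 1)) = 0"
    unfolding add [symmetric] cub by (simp_all add: sdet_def axis_component)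
  have "\<sigma> (axis 0 1) \<noteq> 0" "\<sigma> (axis 1 1) \<noteq> 0" "\<sigma> (axis 2 1) \<noteq> 0"
    using I a k by auto
  moreover have "sadj (axis 0 1 :: 'a ^ 6) = 0" "sadj (axis 1 1 :: 'a ^ 6) = 0"
    "sadj (axis 2 1 :: 'a ^ 6) = 0"
    by (rule vec6_eqI; simp add: sadj_nth axis_component)+
  ultimately have "\<exists>c v. \<sigma> (axis 0 1) = c *s sq v" "\<exists>c v. \<sigma> (axis 1 1) = c *s sq v"
    "\<exists>c v. \<sigma> (axis 2 1) = c *s sq v"
    using sing by blast+
  then obtain l0 x l1 y l2 z where l: "\<sigma> (axis 0 1) = l0 *s sq x" "\<sigma> (axis 1 1) = l1 *s sq y"
      "\<sigma> (axis 2 1) = l2 *s sq z"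
    by blast
  let ?g = "levi x y z" and ?\<delta> = "det3 x y z"
  have \<delta>: "?\<delta> \<noteq> 0" using I k unfolding l sdet_sq_combination by auto
  obtain h where h: "h \<in> GSp std_form" "h ** ?g = mat 1"
    using GSp_inverse [OF levi_GSp [OF \<delta>]] by blast
  have hg: "ext3 h (ext3 ?g (tri a A B d)) = tri a A B d" for a A B d
    using ext3_mult [OF char tri_in_trivectors, of h ?g] ext3_mat_1 [OF char tri_in_trivectors]
    by (simp add: h)
  have hE: "ext3 h (tri \<alpha> 0 0 0) = tri (\<alpha> / ?\<delta>) 0 0 0"
    and hF: "ext3 h (tri 0 0 0 \<beta>) = tri 0 0 0 (\<beta> / ?\<delta>\<^sup>2)"
    using hg [of "\<alpha> / ?\<delta>" 0 0 0] hg [of 0 0 0 "\<beta> / ?\<delta>\<^sup>2"] \<delta>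
    by (simp_all add: ext3_levi_E [OF char] ext3_levi_F [OF char])
  have hB: "ext3 h (tri 0 0 (l0 *s sq x) 0) = tri 0 0 (axis 0 (l0 / ?\<delta>)) 0"
    "ext3 h (tri 0 0 (l1 *s sq y) 0) = tri 0 0 (axis 1 (l1 / ?\<delta>)) 0"
    "ext3 h (tri 0 0 (l2 *s sq z) 0) = tri 0 0 (axis 2 (l2 / ?\<delta>)) 0"
    using hg [of 0 0 "axis 0 (l0 / ?\<delta>)" 0] hg [of 0 0 "axis 1 (l1 / ?\<delta>)" 0]
      hg [of 0 0 "axis 2 (l2 / ?\<delta>)" 0] \<delta>
    by (simp_all add: ext3_levi_B [OF char] axis_component)
  have "is_GSp_map (\<lambda>T. 1 *s ext3 h (\<phi> T))"
    by (rule is_GSp_map_diagonal [OF char similitude_comp [OF char sim h(1)]])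
      (simp_all add: E F B hE hF hB l)
  then show ?thesis by (rule is_GSp_map_cancel [OF char sim h(1) one_neq_zero])
qed

lemma similitude_is_GSp_map:
  fixes k :: "'a::field"
  assumes char: "(2::'a) \<noteq> 0" "(3::'a) \<noteq> 0" and sim: "similitude \<phi> k"
  shows "is_GSp_map \<phi>"
proof -
  obtain a A B d where x: "\<phi> (tri 1 0 0 0) = tri a A B d"
    using similitude_tri_ex [OF char sim] by blast
  have "tri a A B d \<noteq> 0"
    using similitude_kernel [OF char sim, of 1 0 0 0] x tri_eq_iff [of 1 0 0 0 0 0 0 0]
    by (auto simp: tri_zero)
  moreover have "rank_one (tri a A B d)"
    using similitude_rank_one [OF char sim rank_one_E(1) [OF char, of 1]] by (simp add: x)
  ultimately obtain g s where g: "g \<in> GSp std_form" and s: "s \<noteq> 0"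
    and gx: "ext3 g (tri a A B d) = tri s 0 0 0"
    using rank_one_to_E [OF char] by blast
  define \<psi> where "\<psi> = (\<lambda>T. 1 *s ext3 g (\<phi> T))"
  obtain m where sim': "similitude \<psi> m"
    using similitude_comp [OF char sim g, of 1] unfolding \<psi>_def by auto
  have E': "\<psi> (tri 1 0 0 0) = tri s 0 0 0" by (simp add: \<psi>_def x gx)
  obtain a' A' B' d' where y: "\<psi> (tri 0 0 0 1) = tri a' A' B' d'"
    using similitude_tri_ex [OF char sim'] by blast
  \<comment> \<open>The Hessian at E does not vanish on (0, 0, 0, 1), and \<psi> keeps this
    property; hence d' is nonzero.\<close>
  have "(s * d')\<^sup>2 = m"
    using similitude_hess [OF char sim', of 1 0 0 0 0 0 0 1] numeral_neq_0 [OF char]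
    by (simp add: E' y hess_E)
  then have "d' \<noteq> 0" using similitude_quartic(2) [OF char sim'] by auto
  moreover have "rank_one (tri a' A' B' d')"
    using similitude_rank_one [OF char sim' rank_one_E(2) [OF char, of 1]] by (simp add: y)
  ultimately obtain C where C: "ext3 (upper C) (tri a' A' B' d') = tri 0 0 0 d'"
    using rank_one_to_F [OF char] by blast
  have "is_GSp_map (\<lambda>T. 1 *s ext3 (upper C) (\<psi> T))"
    by (rule is_GSp_map_of_lines [OF char similitude_comp [OF char sim' upper_GSp]])
      (simp_all add: E' y C ext3_upper_E)
  then have "is_GSp_map \<psi>" by (rule is_GSp_map_cancel [OF char sim' upper_GSp one_neq_zero])
  then show ?thesis unfolding \<psi>_def by (rule is_GSp_map_cancel [OF char sim g one_neq_zero])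
qed

section \<open>Symplectic bases and scalar extension\<close>

text \<open>One step of symplectic Gram-Schmidt, with \<open>p\<close> projecting to the orthogonal
  complement of S. For v outside the span \<open>p v\<close> is nonzero; nondegeneracy gives w, and
  w may be replaced by \<open>p w\<close> because \<open>p v\<close> is orthogonal to the
  span.\<close>

lemma symplectic_extend:
  fixes b :: "'a::field ^ 6 \<Rightarrow> 'a ^ 6 \<Rightarrow> 'a"
  assumes b: "symplectic_form b" and S: "finite S" "card S < 6"
    and p: "\<And>v. v - p v \<in> vec.span S" "\<And>v s. s \<in> S \<Longrightarrow> b (p v) s = 0"
  shows "\<exists>e f. b e f = 1 \<and> (\<forall>s\<in>S. b e s = 0 \<and> b f s = 0)"
proof -
  have l: "\<And>u. Vector_Spaces.linear (*s) (*) (\<lambda>v. b u v)"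
    and nondeg: "\<And>u. (\<And>v. b u v = 0) \<Longrightarrow> u = 0" and r: "\<And>v. Vector_Spaces.linear (*s) (*) (\<lambda>u. b u v)"
    using b unfolding symplectic_form_def by blast+
  have span: "b u s = 0" if "s \<in> vec.span S" "\<And>s. s \<in> S \<Longrightarrow> b u s = 0" for u s
  proof -
    interpret L: Vector_Spaces.linear "(*s)" "(*)" "\<lambda>v. b u v" by (rule l)
    show ?thesis using that(1)
      by (induction rule: vec.span_induct_alt) (simp_all add: L.zero L.add L.scale that(2))
  qed
  have "vec.span S \<noteq> UNIV"
  proof
    assume "vec.span S = UNIV"
    then have "vec.dim (UNIV :: ('a ^ 6) set) \<le> card S"
      by (intro vec.dim_le_card S(1)) simp
    then show False using S(2) unfolding vec_dim_card by simp
  qed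
  then obtain v where v: "v \<notin> vec.span S" by blast
  have "p v \<noteq> 0" using p(1) [of v] v by auto
  then obtain w where w: "b (p v) w \<noteq> 0" using nondeg by blast
  interpret L: Vector_Spaces.linear "(*s)" "(*)" "\<lambda>w. b (p v) w" by (rule l)
  have "b (p v) (p w) = b (p v) w"
    using span [OF p(1) [of w] p(2) [where v = v]] by (simp add: L.diff)
  then have "b (p v) (inverse (b (p v) w) *s p w) = 1" using w by (simp add: L.scale)
  moreover have "b (inverse (b (p v) w) *s p w) s = 0" if "s \<in> S" for s
  proof -
    interpret R: Vector_Spaces.linear "(*s)" "(*)" "\<lambda>w. b w s" by (rule r)
    show ?thesis using p(2) [OF that] by (simp add: R.scale)
  qed
  ultimately show ?thesis using p(2) by blast
qed

lemma symplectic_basis: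
  fixes b :: "'a::field ^ 6 \<Rightarrow> 'a ^ 6 \<Rightarrow> 'a"
  assumes char: "(2::'a) \<noteq> 0" and b: "symplectic_form b"
  shows "\<exists>h. \<forall>u v. b (h *v u) (h *v v) = std_form u v"
proof -
  have l: "\<And>u. Vector_Spaces.linear (*s) (*) (\<lambda>v. b u v)"
    and r: "\<And>v. Vector_Spaces.linear (*s) (*) (\<lambda>u. b u v)" and skew: "\<And>u v. b u v = - b v u"
    using b unfolding symplectic_form_def by blast+
  have addR: "b u (v + w) = b u v + b u w" and diffR: "b u (v - w) = b u v - b u w"
    and scaleR: "b u (c *s v) = c * b u v" for u v w c
  proof -
    interpret L: Vector_Spaces.linear "(*s)" "(*)" "\<lambda>v. b u v" by (rule l)
    show "b u (v + w) = b u v + b u w" "b u (v - w) = b u v - b u w" "b u (c *s v) = c * b u v"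
      by (rule L.add L.diff L.scale)+
  qed
  have addL: "b (v + w) u = b v u + b w u" and diffL: "b (v - w) u = b v u - b w u"
    and scaleL: "b (c *s v) u = c * b v u" for u v w c
  proof -
    interpret L: Vector_Spaces.linear "(*s)" "(*)" "\<lambda>v. b v u" by (rule r)
    show "b (v + w) u = b v u + b w u" "b (v - w) u = b v u - b w u" "b (c *s v) u = c * b v u"
      by (rule L.add L.diff L.scale)+
  qed
  have alt: "b u u = 0" for u
  proof -
    have "2 * b u u = 0" using skew [of u u] by simp
    then show ?thesis using char by simp
  qed
  have flip: "b f e = - 1" if "b e f = 1" for e f using skew [of f e] that by simp
  have flip0: "b f e = 0" if "b e f = 0" for e f using skew [of f e] that by simp
  obtain e0 f0 where 0: "b e0 f0 = 1"
    using symplectic_extend [OF b, of "{}" "\<lambda>v. v"] by auto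
  have "\<exists>e f. b e f = 1 \<and> (\<forall>s\<in>{e0, f0}. b e s = 0 \<and> b f s = 0)"
  \<comment> \<open>The subtracted vector is the component of v in the hyperbolic plane of e0 and
    f0.\<close>
  proof (rule symplectic_extend [OF b, of _ "\<lambda>v. v - (b v f0 *s e0 - b v e0 *s f0)"])
    show "v - (v - (b v f0 *s e0 - b v e0 *s f0)) \<in> vec.span {e0, f0}" for v
      by (simp add: vec.span_diff vec.span_scale vec.span_base)
    show "b (v - (b v f0 *s e0 - b v e0 *s f0)) s = 0" if "s \<in> {e0, f0}" for v s
      using that by (auto simp: diffL scaleL 0 flip [OF 0] alt)
    show "card {e0, f0} < 6" using card_length [of "[e0, f0]"] by simp
  qed simp
  then obtain e1 f1 where 1: "b e1 f1 = 1" "b e1 e0 = 0" "b e1 f0 = 0" "b f1 e0 = 0" "b f1 f0 = 0"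
    by auto
  have "\<exists>e f. b e f = 1 \<and> (\<forall>s\<in>{e0, f0, e1, f1}. b e s = 0 \<and> b f s = 0)"
  proof (rule symplectic_extend [OF b, of _
        "\<lambda>v. v - (b v f0 *s e0 - b v e0 *s f0 + (b v f1 *s e1 - b v e1 *s f1))"])
    show "v - (v - (b v f0 *s e0 - b v e0 *s f0 + (b v f1 *s e1 - b v e1 *s f1)))
        \<in> vec.span {e0, f0, e1, f1}" for v
      by (simp add: vec.span_add vec.span_diff vec.span_scale vec.span_base)
    show "b (v - (b v f0 *s e0 - b v e0 *s f0 + (b v f1 *s e1 - b v e1 *s f1))) s = 0"
      if "s \<in> {e0, f0, e1, f1}" for v s
      using that
      by (auto simp: diffL addL scaleL 0 flip [OF 0] alt 1 flip [OF 1(1)] 1(2-5) [THEN flip0])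
    show "card {e0, f0, e1, f1} < 6" using card_length [of "[e0, f0, e1, f1]"] by simp
  qed simp
  then obtain e2 f2 where 2: "b e2 f2 = 1" "b e2 e0 = 0" "b e2 f0 = 0" "b f2 e0 = 0" "b f2 f0 = 0"
    "b e2 e1 = 0" "b e2 f1 = 0" "b f2 e1 = 0" "b f2 f1 = 0"
    by auto
  define h where "h = transpose (vec6 e0 e1 e2 f0 f1 f2)"
  have h: "h *v u = u$0 *s e0 + u$1 *s e1 + u$2 *s e2 + u$3 *s f0 + u$4 *s f1 + u$5 *s f2" for u
    by (simp add: vec_eq_iff h_def matrix_vector_mult_def transpose_def sum_6 mult.commute)
  have "b (h *v u) (h *v v) = std_form u v" for u v
    unfolding h
    by (simp add: addL scaleL addR scaleR alt 0 1 2 flip [OF 0] flip [OF 1(1)] flip [OF 2(1)]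
        1(2-5) [THEN flip0] 2(2-9) [THEN flip0] std_form_def)
  then show ?thesis by blast
qed

section \<open>Scalar extension to the algebraic closure\<close>

lemma to_ac_det: "to_ac (det M) = det (\<chi> i j. to_ac (M $ i $ j))"
  by (simp add: det_def to_ac_sum to_ac_prod)

lemma to_ac_eps: "to_ac (eps i j k l m n :: 'a::field) = eps i j k l m n"
proof -
  have "(\<chi> r s. to_ac ((vec6 (axis i (1 :: 'a)) (axis j 1) (axis k 1) (axis l 1) (axis m 1) (axis n 1)) $ r $ s)) =
    vec6 (axis i 1) (axis j 1) (axis k 1) (axis l 1) (axis m 1) (axis n 1)"
    by (rule vec6_eqI; simp add: vec_eq_iff axis_component)
  then show ?thesis unfolding eps_def alt6_def to_ac_det by simp
qed

text \<open>The coefficients of the quartic come from the integers through \<open>eps\<close>, so it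
  commutes with scalar extension.\<close>

lemma to_ac_quartic: "quartic (vec_to_ac T) = to_ac (quartic T)"
  by (simp add: quartic_def hitchin_def trace_def matrix_matrix_mult_def star_axis vec_to_ac_def
      to_ac_sum to_ac_eps)

lemma vec_to_ac_in_trivectors:
  assumes "T \<in> trivectors"
  shows "vec_to_ac T \<in> trivectors"
  unfolding trivectors_def mem_Collect_eq
proof (intro allI)
  fix i j k
  show "vec_to_ac T $ (i, i, k) = 0 \<and> vec_to_ac T $ (i, k, i) = 0 \<and> vec_to_ac T $ (k, i, i) = 0 \<and>
      vec_to_ac T $ (j, i, k) = - vec_to_ac T $ (i, j, k) \<and>
      vec_to_ac T $ (i, k, j) = - vec_to_ac T $ (i, j, k)"
    using assms [unfolded trivectors_def mem_Collect_eq, rule_format, where i = i and j = j and k = k]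
    by (simp add: vec_to_ac_def)
qed

section \<open>Polynomial functions over the closure with coefficients in K\<close>

lemma poly_funs_zero: "(\<lambda>x. 0) \<in> poly_funs"
  unfolding poly_funs_def by (auto intro!: exI [of _ "{}"])

lemma poly_funs_add:
  assumes "F \<in> poly_funs" "G \<in> poly_funs"
  shows "(\<lambda>x. F x + G x) \<in> poly_funs"
proof -
  obtain M a N c where F: "finite M" "F = (\<lambda>x. \<Sum>m\<in>M. to_ac (a m) * monomial_fun m x)"
    and G: "finite N" "G = (\<lambda>x. \<Sum>m\<in>N. to_ac (c m) * monomial_fun m x)"
    using assms unfolding poly_funs_def by blast
  \<comment> \<open>Coefficients are extended by 0, so that a monomial common to \<open>M\<close>
    and \<open>N\<close> gets their sum.\<close>
  let ?e = "\<lambda>m. (if m \<in> M then a m else 0) + (if m \<in> N then c m else 0)"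
  have "F x + G x = (\<Sum>m\<in>M \<union> N. to_ac (?e m) * monomial_fun m x)" for x
  proof -
    have "F x = (\<Sum>m\<in>M \<union> N. to_ac (if m \<in> M then a m else 0) * monomial_fun m x)"
      unfolding F(2) using F(1) G(1) by (intro sum.mono_neutral_cong_left) auto
    moreover have "G x = (\<Sum>m\<in>M \<union> N. to_ac (if m \<in> N then c m else 0) * monomial_fun m x)"
      unfolding G(2) using F(1) G(1) by (intro sum.mono_neutral_cong_left) auto
    ultimately show ?thesis by (simp add: sum.distrib [symmetric] distrib_right)
  qed
  then show ?thesis unfolding poly_funs_def using F(1) G(1)
    by (auto intro!: exI [of _ "M \<union> N"] exI [of _ ?e])
qed

lemma poly_funs_sum: "(\<And>i. i \<in> I \<Longrightarrow> F i \<in> poly_funs) \<Longrightarrow> (\<lambda>x. \<Sum>i\<in>I. F i x) \<in> poly_funs"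
  by (induction I rule: infinite_finite_induct) (simp_all add: poly_funs_zero poly_funs_add)

lemma poly_funs_monomial: "(\<lambda>x. to_ac c * monomial_fun m x) \<in> poly_funs"
  unfolding poly_funs_def by (auto intro!: exI [of _ "{m}"] exI [of _ "\<lambda>_. c"])

lemma poly_funs_mult:
  assumes "F \<in> poly_funs" "G \<in> poly_funs"
  shows "(\<lambda>x. F x * G x) \<in> poly_funs"
proof -
  obtain M a N c where F: "F = (\<lambda>x. \<Sum>m\<in>M. to_ac (a m) * monomial_fun m x)"
    and G: "G = (\<lambda>x. \<Sum>m\<in>N. to_ac (c m) * monomial_fun m x)"
    using assms unfolding poly_funs_def by blast
  \<comment> \<open>Different pairs may give the same monomial; treating each term as a polynomial
    function of its own leaves the collecting to \<open>poly_funs_sum\<close>.\<close>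
  have "F x * G x = (\<Sum>m\<in>M. \<Sum>n\<in>N. to_ac (a m * c n) * monomial_fun (\<lambda>i. m i + n i) x)" for x
    by (simp add: F G sum_product monomial_fun_def power_add prod.distrib ac_simps)
  then show ?thesis by (simp only: poly_funs_sum poly_funs_monomial)
qed

lemma poly_funs_const: "(\<lambda>x. to_ac c) \<in> poly_funs"
  using poly_funs_monomial [of c "\<lambda>_. 0"] by (simp add: monomial_fun_def)

lemma poly_funs_coordinate: "(\<lambda>x :: 'k::field alg_closure ^ 'n. x $ i) \<in> poly_funs"
proof -
  have "(\<lambda>x. to_ac 1 * monomial_fun (\<lambda>j. if j = i then 1 else 0) x) =
      (\<lambda>x :: 'k alg_closure ^ 'n. x $ i)"
    by (simp add: fun_eq_iff monomial_fun_def if_distrib cong: if_cong)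
  then show ?thesis using poly_funs_monomial by metis
qed

lemma quartic_in_poly_funs: "(quartic :: 'k::field alg_closure ^ (6 \<times> 6 \<times> 6) \<Rightarrow> _) \<in> poly_funs"
proof -
  have "(\<lambda>T :: 'k alg_closure ^ (6 \<times> 6 \<times> 6). hitchin T $ a $ b) \<in> poly_funs" for a b
    \<comment> \<open>\<open>poly_funs\<close> asks for coefficients in \<open>K\<close>, hence
      \<open>eps\<close> over the closure is written as \<open>to_ac\<close> of
      \<open>eps\<close>.\<close>
    unfolding hitchin_def star_axis vec_lambda_beta to_ac_eps [symmetric]
    by (intro poly_funs_sum poly_funs_mult poly_funs_const poly_funs_coordinate)
  then have "(\<lambda>T :: 'k alg_closure ^ (6 \<times> 6 \<times> 6). \<Sum>a\<in>UNIV. \<Sum>b\<in>UNIV. hitchin T $ a $ b * hitchin T $ b $ a)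
      \<in> poly_funs"
    by (intro poly_funs_sum poly_funs_mult)
  then show ?thesis
    unfolding quartic_def [abs_def] trace_def matrix_matrix_mult_def by simp
qed

lemma SL6_invariant_quartic_form: "SL6_invariant quartic"
  unfolding SL6_invariant_def by (simp add: quartic_ext3 invertible_det_nz)

lemma of_nat_prime_neq_0:
  assumes "CHAR('a::field) \<noteq> p" "Factorial_Ring.prime p"
  shows "(of_nat p :: 'a) \<noteq> 0"
  using assms CHAR_not_1' by (auto simp: of_nat_eq_0_iff_char_dvd prime_nat_iff)

theorem corollary8p7:
  fixes b :: "'k::field ^ 6 \<Rightarrow> 'k ^ 6 \<Rightarrow> 'k"
    and F :: "'k alg_closure ^ (6 \<times> 6 \<times> 6) \<Rightarrow> 'k alg_closure"
    and \<phi> :: "'k ^ (6 \<times> 6 \<times> 6) \<Rightarrow> 'k ^ (6 \<times> 6 \<times> 6)"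
  assumes "CHAR('k) \<noteq> 2" and "CHAR('k) \<noteq> 3"
    and "symplectic_form b"
    and "SL6_invariant_quartic F"
    and "linear_endo_on (primitive_trivectors b) \<phi>"
    and "preserves_on (primitive_trivectors b) F \<phi>"
  shows "\<exists>c g. c \<noteq> 0 \<and> g \<in> GSp b \<and> c ^ 4 * (det g)\<^sup>2 = 1 \<and>
           (\<forall>T\<in>primitive_trivectors b. \<phi> T = c *s ext3 g T)"
proof -
  have char: "(2::'k) \<noteq> 0" "(3::'k) \<noteq> 0"
    using of_nat_prime_neq_0 [of 2, where 'a = 'k] of_nat_prime_neq_0 [of 3, where 'a = 'k]
      assms(1,2) by simp_all
  note b = assms(3)
  let ?V = "primitive_trivectors b"
    and ?W = "primitive_trivectors std_form :: ('k ^ (6 \<times> 6 \<times> 6)) set"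
  have \<phi>V: "\<phi> x \<in> ?V" if "x \<in> ?V" for x
    using assms(5) that by (simp add: linear_endo_on_def)
  have V: "x \<in> trivectors" if "x \<in> ?V" for x
    using that by (simp add: primitive_trivectors_def)
  have quartic_\<phi>: "quartic (\<phi> x) = quartic x" if x: "x \<in> ?V" for x
  proof -
    obtain p :: "'k poly" where p: "\<And>T. T \<in> trivectors \<Longrightarrow> quartic T = poly (map_poly to_ac p) (F T)"
      using assms(4) quartic_in_poly_funs SL6_invariant_quartic_form
      unfolding SL6_invariant_quartic_def by blast
    \<comment> \<open>One summand with coefficient 1: preservation is used at
      \<open>K\<close>-points.\<close>
    have "F (vec_to_ac (\<phi> x)) = F (vec_to_ac x)"
      using assms(6) [unfolded preserves_on_def, rule_format, of 1 "\<lambda>_. x" "\<lambda>_. 1"] x by simp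
    then have "quartic (vec_to_ac (\<phi> x)) = quartic (vec_to_ac x)"
      using p [OF vec_to_ac_in_trivectors [OF V [OF x]]]
        p [OF vec_to_ac_in_trivectors [OF V [OF \<phi>V [OF x]]]] by simp
    then show ?thesis by (simp add: to_ac_quartic)
  qed
  obtain h where h: "\<And>u v. b (h *v u) (h *v v) = std_form u v"
    using symplectic_basis [OF char(1) b] by blast
  have b0: "b 0 v = 0" for v
  proof -
    interpret L: Vector_Spaces.linear "(*s)" "(*)" "\<lambda>u. b u v"
      using b unfolding symplectic_form_def by blast
    show ?thesis by (rule L.zero)
  qed
  have "invertible h"
    by (rule invertible_of_std_form [of b h 1]) (simp_all add: h b0)
  then obtain h' where hh': "h ** h' = mat 1" "h' ** h = mat 1"
    unfolding invertible_def by blast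
  have h': "std_form (h' *v u) (h' *v v) = b u v" for u v
    using h [of "h' *v u" "h' *v v"] by (simp add: matrix_vector_mul_assoc hh')
  have inv_h': "invertible h'" using hh' unfolding invertible_def by blast
  have det: "det h * det h' = 1" using hh'(1) det_mul [of h h'] by simp
  have hW: "ext3 h T \<in> ?V" if "T \<in> ?W" for T
    using ext3_primitive_trivectors [OF char b symplectic_std_form _ that, of h 1] h by simp
  have hV: "ext3 h' T \<in> ?W" if "T \<in> ?V" for T
    using ext3_primitive_trivectors [OF char symplectic_std_form b _ that, of h' 1] h' by simp
  have hh'T: "ext3 h (ext3 h' T) = T" if "T \<in> trivectors" for T
    using ext3_mult [OF char that, of h h'] ext3_mat_1 [OF char that] hh' by simp
  define \<psi> where "\<psi> = (\<lambda>T. ext3 h' (\<phi> (ext3 h T)))"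
  \<comment> \<open>The factor is 1 because the determinants of h and h' cancel.\<close>
  have sim: "similitude \<psi> 1"
    unfolding similitude_def linear_endo_on_def
  proof (intro conjI ballI allI)
    fix x y c assume x: "x \<in> ?W"
    show "\<psi> x \<in> ?W" unfolding \<psi>_def by (intro hV \<phi>V hW x)
    show "\<psi> (c *s x) = c *s \<psi> x"
      using assms(5) hW [OF x] by (simp add: \<psi>_def ext3_scale linear_endo_on_def)
    have "quartic (\<psi> x) = (det h')\<^sup>2 * ((det h)\<^sup>2 * quartic x)"
      using \<open>invertible h\<close> by (simp add: \<psi>_def quartic_ext3 inv_h' quartic_\<phi> hW x)
    then show "quartic (\<psi> x) = 1 * quartic x"
      using det by (metis mult.assoc mult.commute one_power2 power_mult_distrib)
    assume y: "y \<in> ?W"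
    show "\<psi> (x + y) = \<psi> x + \<psi> y"
      using assms(5) hW [OF x] hW [OF y] by (simp add: \<psi>_def ext3_add linear_endo_on_def)
  qed simp
  then obtain c g where c: "c \<noteq> 0" and g: "g \<in> GSp std_form"
    and \<psi>: "\<And>T. T \<in> ?W \<Longrightarrow> \<psi> T = c *s ext3 g T"
    using similitude_is_GSp_map [OF char] unfolding is_GSp_map_def by blast
  obtain m where m: "m \<noteq> 0" "\<And>u v. std_form (g *v u) (g *v v) = m * std_form u v"
    and inv_g: "invertible g"
    using g unfolding GSp_def by blast
  have "h ** g ** h' \<in> GSp b"
    unfolding GSp_def using m \<open>invertible h\<close> inv_g inv_h'
    by (auto simp: invertible_mult matrix_vector_mul_assoc [symmetric] h h' intro!: exI [of _ m])
  moreover have "c ^ 4 * (det (h ** g ** h'))\<^sup>2 = 1"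
  proof -
    \<comment> \<open>The quartic of this vector is 864, which is nonzero, so comparing it before
      and after \<psi> determines the scaling factor.\<close>
    let ?T = "tri 1 0 0 1 :: 'k ^ (6 \<times> 6 \<times> 6)"
    have T: "?T \<in> ?W" unfolding primitive_trivectors_std_form [OF char(1)] by blast
    obtain a A B d where e: "ext3 g ?T = tri a A B d"
      using similitude_tri_ex [OF char similitude_ext3 [OF char g]] by blast
    have "quartic ?T = quartic (\<psi> ?T)"
      using sim T by (simp add: similitude_def)
    also have "\<dots> = c ^ 4 * quartic (ext3 g ?T)"
      unfolding \<psi> [OF T] e by (rule quartic_tri_scale)
    also have "\<dots> = (c ^ 4 * (det g)\<^sup>2) * quartic ?T"
      by (simp add: quartic_ext3 [OF inv_g])
    finally have "c ^ 4 * (det g)\<^sup>2 = 1"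
      using numeral_neq_0 [OF char] by (simp add: quartic_tri)
    moreover have "det (h ** g ** h') = det g"
      using det by (simp add: det_mul mult.commute mult.left_commute)
    ultimately show ?thesis by simp
  qed
  moreover have "\<phi> T = c *s ext3 (h ** g ** h') T" if T: "T \<in> ?V" for T
  proof -
    have t: "T \<in> trivectors" "ext3 h' T \<in> trivectors"
      using V [OF T] ext3_in_trivectors [OF char] by blast+
    have "\<phi> T = ext3 h (\<psi> (ext3 h' T))"
      by (simp add: \<psi>_def hh'T t V \<phi>V T)
    also have "\<dots> = c *s ext3 (h ** g ** h') T"
      by (simp add: \<psi> [OF hV [OF T]] ext3_scale ext3_mult [OF char] t)
    finally show ?thesis .
  qed
  ultimately show ?thesis using c by blast
qed

end
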